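(* Let $P$ and $Q$ be probability distributions on a measurable space $(\mathcal{X},\mathcal{F})$. Let $\mathcal{F}\supseteq\mathcal{F}_1\supseteq\mathcal{F}_2\supseteq\cdots$ be a decreasing family of $\sigma$-algebras, and let $\mathcal{F}_\infty=\bigcap_{n=1}^\infty\mathcal{F}_n$ be the largest $\sigma$-algebra contained in all of them. Let $\alpha\in[0,\infty)$. If $\alpha\in[0,1)$ or there exists an $m$ such that $D_\alpha(P_{|\mathcal{F}_m}\|Q_{|\mathcal{F}_m})<\infty$, then $$\lim_{n\to\infty}D_\alpha(P_{|\mathcal{F}_n}\|Q_{|\mathcal{F}_n})=D_\alpha(P_{|\mathcal{F}_\infty}\|Q_{|\mathcal{F}_\infty}).$$
   Context: $P_{|\mathcal{G}}$ denotes the restriction of $P$ to the sub-$\sigma$-algebra $\mathcal{G}\subseteq\mathcal{F}$. Rényi divergence: let $P,Q$ be probability distributions on a measurable space with densities $p,q$ with respect to a dominating $\sigma$-finite measure $\mu$ (whose choice is immaterial). For $\alpha\in(0,1)\cup(1,\infty)$, $D_\alpha(P\|Q)=\frac{1}{\alpha-1}\ln\int p^\alpha q^{1-\alpha}\,d\mu\in[0,\infty]$, where for $\alpha>1$ one reads $p^\alpha q^{1-\alpha}$ as $p^\alpha/q^{\alpha-1}$ with the conventions $0/0=0$ and $x/0=\infty$ for $x>0$. Further $D_0(P\|Q)=\lim_{\alpha\downarrow0}D_\alpha(P\|Q)$ and $D_1(P\|Q)=\lim_{\alpha\uparrow1}D_\alpha(P\|Q)$ (these limits always exist in $[0,\infty]$;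 $D_1$ is the Kullback-Leibler divergence). *)

theory Defs
  imports "HOL-Probability.Probability"
begin

definition sum_measure :: "'a measure \<Rightarrow> 'a measure \<Rightarrow> 'a measure" where
  "sum_measure P Q = measure_of (space P) (sets P) (\<lambda>A. emeasure P A + emeasure Q A)"

definition ln_ennreal :: "ennreal \<Rightarrow> ereal" where
  "ln_ennreal x = (if x = 0 then -\<infinity> else if x = \<infinity> then \<infinity> else ereal (ln (enn2real x)))"

text \<open>
  The value of \<open>p\<^sup>\<alpha> q\<^bsup>1-\<alpha>\<^esup>\<close> at a point, for densities with nonnegative real values;
  for \<open>\<alpha> > 1\<close> it is read as \<open>p\<^sup>\<alpha> / q\<^bsup>\<alpha>-1\<^esup>\<close> with \<open>0/0 = 0\<close> and \<open>x/0 = \<infinity>\<close> for \<open>x > 0\<close>.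
\<close>
definition renyi_integrand :: "real \<Rightarrow> real \<Rightarrow> real \<Rightarrow> ennreal" where
  "renyi_integrand \<alpha> p q =
    (if \<alpha> < 1 then ennreal (p powr \<alpha> * q powr (1 - \<alpha>))
     else if q = 0 then (if p = 0 then 0 else \<infinity>)
     else ennreal (p powr \<alpha> / q powr (\<alpha> - 1)))"

text \<open>
  The dominating measure is fixed to be \<open>P + Q\<close>; the lemma \<open>renyi_simple_density\<close> below
  shows that every other choice gives the same value. Densities with respect to it are almost
  everywhere finite, so \<open>enn2real\<close> changes them on a null set only.
\<close>
definition renyi_simple :: "real \<Rightarrow> 'a measure \<Rightarrow> 'a measure \<Rightarrow> ereal" where
  "renyi_simple \<alpha> P Q = (let \<mu> = sum_measure P Q in
     ereal (1 / (\<alpha> - 1)) * ln_ennreal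
       (\<integral>\<^sup>+ x. renyi_integrand \<alpha> (enn2real (RN_deriv \<mu> P x)) (enn2real (RN_deriv \<mu> Q x)) \<partial>\<mu>))"

definition renyi_divergence :: "real \<Rightarrow> 'a measure \<Rightarrow> 'a measure \<Rightarrow> ereal" where
  "renyi_divergence \<alpha> P Q =
    (if \<alpha> = 0 then Lim (at_right 0) (\<lambda>\<beta>. renyi_simple \<beta> P Q)
     else if \<alpha> = 1 then Lim (at_left 1) (\<lambda>\<beta>. renyi_simple \<beta> P Q)
     else renyi_simple \<alpha> P Q)"

definition inter_algebra :: "(nat \<Rightarrow> 'a measure) \<Rightarrow> 'a measure" where
  "inter_algebra F = sigma (space (F 0)) (\<Inter>n. sets (F n))"

lemma
  assumes "\<And>n. subalgebra M (F n)"
  shows space_inter_algebra: "space (inter_algebra F) = space M"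
    and sets_inter_algebra: "sets (inter_algebra F) = (\<Inter>n. sets (F n))"
    and subalgebra_inter_algebra: "subalgebra M (inter_algebra F)"
proof -
  have sp: "space (F n) = space M" for n using assms by (simp add: subalgebra_def)
  have "sigma_algebra (space M) (\<Inter>n. sets (F n))"
    unfolding sigma_algebra_iff2
  proof (intro conjI ballI allI impI)
    show "(\<Inter>n. sets (F n)) \<subseteq> Pow (space M)"
      using sets.space_closed[of "F 0"] unfolding sp by blast
    show "space M - A \<in> (\<Inter>n. sets (F n))" if "A \<in> (\<Inter>n. sets (F n))" for A
      using that sets.compl_sets[of A] sp by (metis INT_iff)
    show "(\<Union>i. A i) \<in> (\<Inter>n. sets (F n))"
      if "range A \<subseteq> (\<Inter>n. sets (F n))" for A :: "nat \<Rightarrow> 'a set"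
      using that by (intro INT_I sets.countable_UN) auto
  qed auto
  then show 2: "sets (inter_algebra F) = (\<Inter>n. sets (F n))"
    unfolding inter_algebra_def sp by (rule sigma_algebra.sets_measure_of_eq)
  show 1: "space (inter_algebra F) = space M"
    unfolding inter_algebra_def by (simp add: sp space_measure_of_conv)
  show "subalgebra M (inter_algebra F)"
    using assms[of 0] unfolding subalgebra_def 1 2 by auto
qed

lemma renyi_integrand_measurable [measurable]:
  assumes [measurable]: "f \<in> borel_measurable M" "g \<in> borel_measurable M"
  shows "(\<lambda>x. renyi_integrand \<alpha> (f x) (g x)) \<in> borel_measurable M"
  unfolding renyi_integrand_def by measurable

lemma renyi_integrand_scale:
  assumes "0 < \<alpha>" "\<alpha> \<noteq> 1" "0 \<le> c" "0 \<le> p" "0 \<le> q"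
  shows "renyi_integrand \<alpha> (c * p) (c * q) = ennreal c * renyi_integrand \<alpha> p q"
proof (cases "c = 0")
  case True
  then show ?thesis by (simp add: renyi_integrand_def)
next
  case False
  then have c: "0 < c" using assms by simp
  have 1: "c powr \<alpha> * c powr (1 - \<alpha>) = c"
    using c by (simp flip: powr_add)
  have 2: "c powr \<alpha> / c powr (\<alpha> - 1) = c"
    using c by (simp flip: powr_diff)
  have "(c * p) powr \<alpha> * (c * q) powr (1 - \<alpha>) = (c powr \<alpha> * c powr (1 - \<alpha>)) * (p powr \<alpha> * q powr (1 - \<alpha>))"
    using assms by (simp add: powr_mult)
  then have 3: "(c * p) powr \<alpha> * (c * q) powr (1 - \<alpha>) = c * (p powr \<alpha> * q powr (1 - \<alpha>))"
    unfolding 1 .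
  have "(c * p) powr \<alpha> / (c * q) powr (\<alpha> - 1) = (c powr \<alpha> / c powr (\<alpha> - 1)) * (p powr \<alpha> / q powr (\<alpha> - 1))"
    using assms by (simp add: powr_mult)
  then have 4: "(c * p) powr \<alpha> / (c * q) powr (\<alpha> - 1) = c * (p powr \<alpha> / q powr (\<alpha> - 1))"
    unfolding 2 .
  show ?thesis
    unfolding renyi_integrand_def 3 4 using c
    by (auto simp: ennreal_mult' ennreal_mult_top simp del: times_divide_eq_right)
qed

lemma sum_measure_density:
  fixes p q :: "'a \<Rightarrow> real"
  assumes [measurable]: "p \<in> borel_measurable \<mu>" "q \<in> borel_measurable \<mu>"
    and nn: "\<And>x. 0 \<le> p x" "\<And>x. 0 \<le> q x"
  shows "sum_measure (density \<mu> p) (density \<mu> q) = density \<mu> (\<lambda>x. p x + q x)"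
proof (rule measure_eqI)
  show s: "sets (sum_measure (density \<mu> p) (density \<mu> q)) = sets (density \<mu> (\<lambda>x. p x + q x))"
    unfolding sum_measure_def by (simp add: sets.sets_measure_of_eq)
  fix A assume "A \<in> sets (sum_measure (density \<mu> p) (density \<mu> q))"
  then have A[measurable]: "A \<in> sets \<mu>" using s by simp
  have eq: "emeasure (density \<mu> p) B + emeasure (density \<mu> q) B = emeasure (density \<mu> (\<lambda>x. p x + q x)) B"
    if [measurable]: "B \<in> sets \<mu>" for B
    using nn by (simp add: emeasure_density nn_integral_add[symmetric] distrib_right)
  have "emeasure (sum_measure (density \<mu> p) (density \<mu> q)) A =
      emeasure (density \<mu> p) A + emeasure (density \<mu> q) A"
  proof (rule emeasure_measure_of[OF sum_measure_def])
    show "countably_additive (sets (sum_measure (density \<mu> p) (density \<mu> q)))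
        (\<lambda>A. emeasure (density \<mu> p) A + emeasure (density \<mu> q) A)"
      unfolding s by (intro countably_additiveI)
        (simp add: suminf_emeasure image_subset_iff eq[symmetric] sets.countable_UN suminf_add[symmetric])
  qed (use A s sets.sets_into_space in \<open>auto simp: positive_def\<close>)
  then show "emeasure (sum_measure (density \<mu> p) (density \<mu> q)) A = emeasure (density \<mu> (\<lambda>x. p x + q x)) A"
    using eq[OF A] by simp
qed

lemma renyi_simple_density:
  fixes p q :: "'a \<Rightarrow> real"
  assumes [measurable]: "p \<in> borel_measurable \<mu>" "q \<in> borel_measurable \<mu>"
    and nn: "\<And>x. 0 \<le> p x" "\<And>x. 0 \<le> q x"
    and P: "prob_space (density \<mu> p)" and Q: "prob_space (density \<mu> q)"
    and \<alpha>: "0 < \<alpha>" "\<alpha> \<noteq> 1"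
  shows "renyi_simple \<alpha> (density \<mu> p) (density \<mu> q) =
    ereal (1 / (\<alpha> - 1)) * ln_ennreal (\<integral>\<^sup>+ x. renyi_integrand \<alpha> (p x) (q x) \<partial>\<mu>)"
proof -
  define \<nu> where "\<nu> = density \<mu> (\<lambda>x. p x + q x)"
  have [measurable_cong]: "sets \<nu> = sets \<mu>" by (simp add: \<nu>_def)
  have ip: "(\<integral>\<^sup>+x. p x \<partial>\<mu>) = 1" "(\<integral>\<^sup>+x. q x \<partial>\<mu>) = 1"
    using prob_space.emeasure_space_1[OF P] prob_space.emeasure_space_1[OF Q]
    by (simp_all add: emeasure_density cong: nn_integral_cong)
  have "emeasure \<nu> (space \<nu>) = (\<integral>\<^sup>+x. ennreal (p x) + ennreal (q x) \<partial>\<mu>)"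
    unfolding \<nu>_def by (simp add: emeasure_density nn cong: nn_integral_cong)
  also have "\<dots> = 2" by (subst nn_integral_add) (auto simp: ip)
  finally interpret \<nu>: finite_measure \<nu> by (intro finite_measureI) simp
  have dens: "density \<mu> f = density \<nu> (\<lambda>x. f x / (p x + q x))"
    if [measurable]: "f \<in> borel_measurable \<mu>" and f: "\<And>x. 0 \<le> f x" "\<And>x. f x \<le> p x + q x"
    for f :: "'a \<Rightarrow> real"
  proof -
    have "ennreal (p x + q x) * ennreal (f x / (p x + q x)) = ennreal (f x)" for x
      using f[of x] nn[of x] by (cases "p x + q x = 0") (simp_all del: ennreal_plus flip: ennreal_mult')
    then show ?thesis
      unfolding \<nu>_def by (subst density_density_eq) (auto simp: nn)
  qed
  have AE: "AE x in \<nu>. ennreal (p x / (p x + q x)) = RN_deriv \<nu> (density \<mu> p) x"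
    "AE x in \<nu>. ennreal (q x / (p x + q x)) = RN_deriv \<nu> (density \<mu> q) x"
    by (intro \<nu>.RN_deriv_unique dens[symmetric]; simp add: nn)+
  have "(\<integral>\<^sup>+ x. renyi_integrand \<alpha> (enn2real (RN_deriv \<nu> (density \<mu> p) x))
          (enn2real (RN_deriv \<nu> (density \<mu> q) x)) \<partial>\<nu>)
      = (\<integral>\<^sup>+ x. renyi_integrand \<alpha> (p x / (p x + q x)) (q x / (p x + q x)) \<partial>\<nu>)"
  proof (intro nn_integral_cong_AE)
    from AE show "AE x in \<nu>. renyi_integrand \<alpha> (enn2real (RN_deriv \<nu> (density \<mu> p) x))
          (enn2real (RN_deriv \<nu> (density \<mu> q) x))
        = renyi_integrand \<alpha> (p x / (p x + q x)) (q x / (p x + q x))"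
    proof eventually_elim
      case (elim x)
      then show ?case by (simp add: nn flip: elim)
    qed
  qed
  also have "\<dots> = (\<integral>\<^sup>+ x. ennreal (p x + q x) *
      renyi_integrand \<alpha> (p x / (p x + q x)) (q x / (p x + q x)) \<partial>\<mu>)"
    unfolding \<nu>_def by (subst nn_integral_density) auto
  also have "\<dots> = (\<integral>\<^sup>+ x. renyi_integrand \<alpha> (p x) (q x) \<partial>\<mu>)"
  proof (rule nn_integral_cong)
    fix x
    have "p x = (p x + q x) * (p x / (p x + q x))" "q x = (p x + q x) * (q x / (p x + q x))"
      using nn[of x] by (cases "p x + q x = 0"; simp)+
    then show "ennreal (p x + q x) * renyi_integrand \<alpha> (p x / (p x + q x)) (q x / (p x + q x))
        = renyi_integrand \<alpha> (p x) (q x)"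
      using renyi_integrand_scale[OF \<alpha>, of "p x + q x" "p x / (p x + q x)" "q x / (p x + q x)"] nn[of x]
      by simp
  qed
  finally show ?thesis
    unfolding renyi_simple_def Let_def sum_measure_density[OF assms(1-4)] \<nu>_def[symmetric] by simp
qed

end

theory Submission
  imports Defs
begin

text \<open>Let \<open>p\<close> and \<open>1 - p\<close> be the densities of \<open>P\<close> and \<open>Q\<close> with respect to \<open>P + Q\<close>. On a
  sub-\<open>\<sigma>\<close>-algebra \<open>G\<close> the densities become \<open>p\<^sub>G = E[p | G]\<close> and \<open>1 - p\<^sub>G\<close>, so \<open>D\<^sub>\<alpha>\<close> is a continuous function
  of \<open>\<integral>h(p\<^sub>G)\<close> for some \<open>h\<close> that is continuous on \<open>(0,1)\<close>. By the downward martingale theorem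
  \<open>p\<^sub>n \<rightarrow> p\<^sub>\<infinity>\<close> in \<open>L\<^sup>1\<close>, hence almost everywhere along subsequences. For \<open>\<alpha> < 1\<close> the function \<open>h\<close> is bounded;
  for \<open>\<alpha> \<ge> 1\<close> it is convex, and Jensen's inequality dominates \<open>h(p\<^sub>n)\<close> by \<open>E[h(p\<^sub>m) | F\<^sub>n]\<close>, which
  converges in \<open>L\<^sup>1\<close> by the same martingale theorem. Either way the integrals converge.\<close>

section \<open>Downward martingale convergence in \<open>L\<^sup>1\<close>\<close>

text \<open>A likelihood ratio dP/dQ need not exist, since P may charge Q-null sets. The density
  with respect to P + Q always exists and has values in [0,1], so one bounded random variable
  carries both measures, and the ratio p/q becomes the odds t/(1-t). The price is paid at the
  endpoints: for \<alpha> = 0 the function h jumps at 0, and for \<alpha> \<ge> 1 it is infinite at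
  1. This is why continuity of h is asked for on the open interval only.

  The orders 0 and 1 are themselves limits, and exchanging such a limit with the one in n has to be
  avoided. The limit in the order is therefore computed for one fixed \<sigma>-algebra and gives an
  integral of its own: the Q-mass of {p > 0} for order 0, the Kullback-Leibler integral for order 1.
  After that, n tends to infinity in the same way as for the other orders.\<close>

text \<open>Convergence in L1 yields almost everywhere convergence along a subsequence only; this
  criterion brings the integrals back to the full sequence.\<close>

lemma tendsto_if_subseq_subseq:
  fixes f :: "nat \<Rightarrow> 'a :: topological_space"
  assumes "\<And>r :: nat \<Rightarrow> nat. strict_mono r \<Longrightarrow> \<exists>s. strict_mono s \<and> (\<lambda>k. f (r (s k))) \<longlonglongrightarrow> l"
  shows "f \<longlonglongrightarrow> l"
proof (rule ccontr)
  assume "\<not> f \<longlonglongrightarrow> l"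
  then obtain S where S: "open S" "l \<in> S" and "\<not> eventually (\<lambda>n. f n \<in> S) sequentially"
    unfolding tendsto_def by blast
  then have "infinite {n. f n \<notin> S}"
    by (simp add: eventually_cofinite flip: cofinite_eq_sequentially)
  then obtain r :: "nat \<Rightarrow> nat" where r: "strict_mono r" "\<And>n. f (r n) \<notin> S"
    using infinite_enumerate[of "{n. f n \<notin> S}"] by auto
  obtain s where "(\<lambda>k. f (r (s k))) \<longlonglongrightarrow> l" using assms[OF r(1)] by auto
  from topological_tendstoD[OF this S] have "\<forall>\<^sub>F k in sequentially. f (r (s k)) \<in> S" .
  then show False using r(2) by simp
qed

lemma (in sigma_finite_subalgebra) real_cond_exp_abs_le:
  assumes X: "integrable M X" and "AE x in M. \<bar>X x\<bar> \<le> C"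
  shows "AE x in M. \<bar>real_cond_exp M F X x\<bar> \<le> C"
proof -
  have "AE x in M. X x \<le> C" "AE x in M. - C \<le> X x" using assms(2) by (eventually_elim, linarith)+
  from real_cond_exp_le_c[OF X this(1)] real_cond_exp_ge_c[OF X this(2)]
  show ?thesis by eventually_elim linarith
qed

lemma (in sigma_finite_subalgebra) real_cond_exp_L1_contraction:
  assumes [measurable]: "integrable M f"
  shows "(\<integral>x. \<bar>real_cond_exp M F f x\<bar> \<partial>M) \<le> (\<integral>x. \<bar>f x\<bar> \<partial>M)"
proof -
  have "AE x in M. real_cond_exp M F f x \<le> real_cond_exp M F (\<lambda>x. \<bar>f x\<bar>) x"
    by (rule real_cond_exp_mono) (auto simp: assms)
  moreover have "AE x in M. real_cond_exp M F (\<lambda>x. - 1 * f x) x \<le> real_cond_exp M F (\<lambda>x. \<bar>f x\<bar>) x"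
    by (rule real_cond_exp_mono) (auto simp: assms)
  moreover have "AE x in M. real_cond_exp M F (\<lambda>x. - 1 * f x) x = - 1 * real_cond_exp M F f x"
    by (rule real_cond_exp_cmult[OF assms])
  ultimately have "AE x in M. \<bar>real_cond_exp M F f x\<bar> \<le> real_cond_exp M F (\<lambda>x. \<bar>f x\<bar>) x"
    by eventually_elim linarith
  then have "(\<integral>x. \<bar>real_cond_exp M F f x\<bar> \<partial>M) \<le> (\<integral>x. real_cond_exp M F (\<lambda>x. \<bar>f x\<bar>) x \<partial>M)"
    by (intro integral_mono_AE) (auto simp: assms real_cond_exp_int)
  also have "\<dots> = (\<integral>x. \<bar>f x\<bar> \<partial>M)"
    by (intro real_cond_exp_int) (simp add: assms)
  finally show ?thesis .
qed

lemma subalgebra_decseq: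
  assumes "\<And>n. subalgebra M (F n)" "\<And>n. sets (F (Suc n)) \<subseteq> sets (F n)" "m \<le> n"
  shows "subalgebra (F m) (F n)"
  using lift_Suc_antimono_le[of "\<lambda>n. sets (F n)" m n] assms by (simp add: subalgebra_def)

text \<open>The measure is finite rather than a probability because it will be P + Q, of total mass
  2.\<close>

locale backward_filtration = finite_measure M for M :: "'a measure" +
  fixes F :: "nat \<Rightarrow> 'a measure"
  assumes subalg: "\<And>n. subalgebra M (F n)"
    and decseq: "\<And>n. sets (F (Suc n)) \<subseteq> sets (F n)"
begin

sublocale F: finite_measure_subalgebra M "F n" for n
  by unfold_locales (rule subalg)

sublocale Inf: finite_measure_subalgebra M "inter_algebra F"
  by unfold_locales (rule subalgebra_inter_algebra[OF subalg])

lemma F_decseq: "m \<le> n \<Longrightarrow> subalgebra (F m) (F n)"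
  by (rule subalgebra_decseq[of M F, OF subalg decseq])

lemma inter_subalg: "subalgebra (F n) (inter_algebra F)"
  using subalg by (auto simp: subalgebra_def space_inter_algebra[OF subalg] sets_inter_algebra[OF subalg])

lemma measurable_inter_algebra:
  assumes "\<And>n. f \<in> measurable (F n) N"
  shows "f \<in> measurable (inter_algebra F) N"
proof (rule measurableI)
  have sp: "space (F n) = space M" for n using subalg by (simp add: subalgebra_def)
  show "f x \<in> space N" if "x \<in> space (inter_algebra F)" for x
    using that assms[of 0] by (auto simp: space_inter_algebra[OF subalg] sp measurable_def)
  show "f -` A \<inter> space (inter_algebra F) \<in> sets (inter_algebra F)" if "A \<in> sets N" for A
    using measurable_sets[OF assms that]
    by (simp add: space_inter_algebra[OF subalg] sets_inter_algebra[OF subalg] sp)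
qed

abbreviation "E \<equiv> real_cond_exp M"

text \<open>Martingale increments are orthogonal: pulling out the coarser factor and the tower
  property give \<open>eq\<close>, so the squared distance is a difference of the second moments
  \<open>a\<close>. These decrease and are nonnegative, hence form a Cauchy sequence.\<close>

lemma cond_exp_L2_Cauchy:
  assumes [measurable]: "X \<in> borel_measurable M" and bdd: "\<And>x. \<bar>X x\<bar> \<le> C" and e: "0 < e"
  shows "\<exists>N. \<forall>i\<ge>N. \<forall>j\<ge>N. (\<integral>x. (E (F i) X x - E (F j) X x)\<^sup>2 \<partial>M) < e"
proof -
  have X: "integrable M X" by (rule integrable_const_bound[of _ C]) (auto simp: bdd)
  have Xn [measurable]: "E (F n) X \<in> borel_measurable M" for n
    by (rule borel_measurable_cond_exp2)
  have bn: "AE x in M. \<bar>E (F n) X x\<bar> \<le> C" for n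
    by (rule F.real_cond_exp_abs_le[OF X]) (simp add: bdd)
  have prod: "integrable M (\<lambda>x. E (F n) X x * E (F m) X x)" for n m
  proof (rule integrable_const_bound[of _ "C * C"])
    show "AE x in M. norm (E (F n) X x * E (F m) X x) \<le> C * C"
      using bn[of n] bn[of m] by eventually_elim (auto simp: abs_mult intro!: mult_mono)
  qed auto
  define a where "a n = (\<integral>x. E (F n) X x * E (F n) X x \<partial>M)" for n
  have eq: "(\<integral>x. (E (F m) X x - E (F n) X x)\<^sup>2 \<partial>M) = a m - a n" if "m \<le> n" for m n
  proof -
    have "(\<integral>x. E (F n) X x * E (F m) X x \<partial>M) = (\<integral>x. E (F n) X x * E (F n) (E (F m) X) x \<partial>M)"
      by (rule F.real_cond_exp_intg(2)[symmetric]) (auto simp: prod)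
    also have "\<dots> = a n"
      unfolding a_def
    proof (rule integral_cong_AE)
      have "AE x in M. E (F n) (E (F m) X) x = E (F n) X x"
        using F.real_cond_exp_nested_subalg[OF subalg F_decseq[OF that] X] .
      then show "AE x in M. E (F n) X x * E (F n) (E (F m) X) x = E (F n) X x * E (F n) X x"
        by eventually_elim simp
    qed (auto intro!: borel_measurable_times simp: borel_measurable_cond_exp2)
    finally have *: "(\<integral>x. E (F n) X x * E (F m) X x \<partial>M) = a n" .
    have "(\<integral>x. (E (F m) X x - E (F n) X x)\<^sup>2 \<partial>M)
      = (\<integral>x. E (F m) X x * E (F m) X x - 2 * (E (F n) X x * E (F m) X x) + E (F n) X x * E (F n) X x \<partial>M)"
      by (simp add: power2_eq_square algebra_simps)
    also have "\<dots> = a m - 2 * a n + a n"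
      using prod by (simp add: a_def *)
    finally show ?thesis by simp
  qed
  have dec: "decseq a"
    unfolding decseq_def
  proof (intro allI impI)
    fix m n :: nat assume "m \<le> n"
    have "0 \<le> (\<integral>x. (E (F m) X x - E (F n) X x)\<^sup>2 \<partial>M)" by simp
    then show "a n \<le> a m" using eq[OF \<open>m \<le> n\<close>] by simp
  qed
  moreover have "0 \<le> a n" for n by (simp add: a_def)
  ultimately obtain L where "a \<longlonglongrightarrow> L"
    using decseq_convergent[of a 0] by metis
  then have "Cauchy a" by (rule LIMSEQ_imp_Cauchy)
  then obtain N where N: "\<And>i j. i \<ge> N \<Longrightarrow> j \<ge> N \<Longrightarrow> \<bar>a i - a j\<bar> < e"
    using e unfolding Cauchy_def dist_real_def by blast
  have "(\<integral>x. (E (F i) X x - E (F j) X x)\<^sup>2 \<partial>M) < e" if "i \<ge> N" "j \<ge> N" for i j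
  proof (cases "i \<le> j")
    case True
    then show ?thesis using eq[OF True] N[OF that] by auto
  next
    case False
    then have "j \<le> i" by simp
    then show ?thesis using eq[of j i] N[OF that] by (auto simp: power2_commute)
  qed
  then show ?thesis by blast
qed

text \<open>On a finite measure the L2 estimate controls L1: the pointwise inequality y \<le> d +
  y^2/d splits the error into two halves.\<close>

lemma cond_exp_L1_Cauchy:
  assumes [measurable]: "X \<in> borel_measurable M" and bdd: "\<And>x. \<bar>X x\<bar> \<le> C" and e: "0 < e"
  shows "\<exists>N. \<forall>i\<ge>N. \<forall>j\<ge>N. (\<integral>x. \<bar>E (F i) X x - E (F j) X x\<bar> \<partial>M) < e"
proof -
  have X: "integrable M X" by (rule integrable_const_bound[of _ C]) (auto simp: bdd)
  have Xn [measurable]: "E (F n) X \<in> borel_measurable M" for n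
    by (rule borel_measurable_cond_exp2)
  have bn: "AE x in M. \<bar>E (F n) X x\<bar> \<le> C" for n
    by (rule F.real_cond_exp_abs_le[OF X]) (simp add: bdd)
  \<comment> \<open>Chosen so that the constant term contributes at most e/2; the added 1 keeps the
    denominator positive for the zero measure. The L2 threshold d * e / 2 gives the other half after
    division by d.\<close>
  define d where "d = e / (2 * (measure M (space M) + 1))"
  have pos: "0 < 2 * (measure M (space M) + 1)"
    by (simp add: add_nonneg_pos)
  have d: "0 < d" using e pos by (simp add: d_def)
  have dM: "d * measure M (space M) \<le> e / 2"
  proof -
    have "d * (2 * (measure M (space M) + 1)) = e" using pos by (simp add: d_def)
    then show ?thesis using d by (simp add: algebra_simps)
  qed
  obtain N where N: "\<And>i j. i \<ge> N \<Longrightarrow> j \<ge> N \<Longrightarrow> (\<integral>x. (E (F i) X x - E (F j) X x)\<^sup>2 \<partial>M) < d * e / 2"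
    using cond_exp_L2_Cauchy[OF assms(1) bdd, of "d * e / 2"] d e by auto
  have "(\<integral>x. \<bar>E (F i) X x - E (F j) X x\<bar> \<partial>M) < e" if "i \<ge> N" "j \<ge> N" for i j
  proof -
    have [simp]: "integrable M (\<lambda>x. (E (F i) X x - E (F j) X x)\<^sup>2)"
    proof (rule integrable_const_bound[of _ "(2 * C)\<^sup>2"])
      show "AE x in M. norm ((E (F i) X x - E (F j) X x)\<^sup>2) \<le> (2 * C)\<^sup>2"
        using bn[of i] bn[of j]
      proof eventually_elim
        case (elim x)
        then have "\<bar>E (F i) X x - E (F j) X x\<bar> \<le> \<bar>2 * C\<bar>" by linarith
        then show ?case by (simp only: abs_le_square_iff real_norm_def abs_power2)
      qed
    qed auto
    have "(\<integral>x. \<bar>E (F i) X x - E (F j) X x\<bar> \<partial>M)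
      \<le> (\<integral>x. d + (E (F i) X x - E (F j) X x)\<^sup>2 / d \<partial>M)"
    proof (rule integral_mono)
      fix x
      have "y \<le> d + y\<^sup>2 / d" if "0 \<le> y" for y :: real
      proof (cases "y \<le> d")
        case True
        then show ?thesis using d by (simp add: add_increasing2)
      next
        case False
        then have "y \<le> y\<^sup>2 / d" using d that by (simp add: field_simps power2_eq_square mult_left_mono)
        then show ?thesis using d by linarith
      qed
      from this[of "\<bar>E (F i) X x - E (F j) X x\<bar>"]
      show "\<bar>E (F i) X x - E (F j) X x\<bar> \<le> d + (E (F i) X x - E (F j) X x)\<^sup>2 / d" by simp
    qed (auto simp: F.real_cond_exp_int(1)[OF X])
    also have "\<dots> = d * measure M (space M) + (\<integral>x. (E (F i) X x - E (F j) X x)\<^sup>2 \<partial>M) / d"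
      by simp
    also have "\<dots> < e / 2 + (d * e / 2) / d"
      using N[OF that] d dM by (intro add_le_less_mono divide_strict_right_mono) auto
    also have "\<dots> = e" using d by simp
    finally show ?thesis .
  qed
  then show ?thesis by blast
qed

text \<open>A Cauchy sequence in L1 has an almost everywhere convergent subsequence. Its limit
  \<open>Z\<close> depends only on tails, so it is measurable for every \<open>F n\<close>, and
  passing to the limit in the integrals over sets of the intersection identifies it with the
  conditional expectation. The distances \<open>b n\<close> to \<open>Z\<close> decrease, so their
  limit along the subsequence is the limit of all of them.\<close>

lemma cond_exp_L1_tendsto_bounded:
  assumes [measurable]: "X \<in> borel_measurable M" and bdd: "\<And>x. \<bar>X x\<bar> \<le> C"
  shows "(\<lambda>n. \<integral>x. \<bar>E (F n) X x - E (inter_algebra F) X x\<bar> \<partial>M) \<longlonglongrightarrow> 0"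
proof -
  have X: "integrable M X" by (rule integrable_const_bound[of _ C]) (auto simp: bdd)
  have Xn [measurable]: "E (F n) X \<in> borel_measurable M" for n
    by (rule borel_measurable_cond_exp2)
  have bn: "AE x in M. \<bar>E (F n) X x\<bar> \<le> C" for n
    by (rule F.real_cond_exp_abs_le[OF X]) (simp add: bdd)
  obtain r where r: "strict_mono r" and Cau: "AE x in M. Cauchy (\<lambda>i. E (F (r i)) X x)"
    using cauchy_L1_AE_cauchy_subseq[of M "\<lambda>n. E (F n) X"] cond_exp_L1_Cauchy[OF assms]
      F.real_cond_exp_int(1)[OF X] unfolding real_norm_def by blast
  define Z where "Z x = lim (\<lambda>i. E (F (r i)) X x)" for x
  have conv: "AE x in M. (\<lambda>i. E (F (r i)) X x) \<longlonglongrightarrow> Z x"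
    using Cau by eventually_elim (simp add: Z_def convergent_LIMSEQ_iff[symmetric] Cauchy_convergent_iff)
  have ZF: "Z \<in> borel_measurable (F n)" for n
  proof -
    \<comment> \<open>Equality is needed at every point, including those where the sequence diverges
      and \<open>lim\<close> is a default value. A shift leaves the set of limits unchanged, so both
      sides pick the same value.\<close>
    have "Z = (\<lambda>x. lim (\<lambda>i. E (F (r (i + n))) X x))"
      unfolding Z_def lim_def
      by (intro ext arg_cong[where f=The] iffI; erule LIMSEQ_ignore_initial_segment LIMSEQ_offset)
    moreover have "E (F (r (i + n))) X \<in> borel_measurable (F n)" for i
    proof (rule measurable_from_subalg[OF F_decseq borel_measurable_cond_exp])
      show "n \<le> r (i + n)" using strict_mono_imp_increasing[OF r, of "i + n"] by simp
    qed
    ultimately show ?thesis by (simp add: borel_measurable_lim_metric)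
  qed
  have ZI: "Z \<in> borel_measurable (inter_algebra F)" by (rule measurable_inter_algebra) (rule ZF)
  have [measurable]: "Z \<in> borel_measurable M" by (rule measurable_from_subalg[OF Inf.subalg ZI])
  have "AE x in M. \<forall>n. \<bar>E (F n) X x\<bar> \<le> C" by (simp add: AE_all_countable bn)
  with conv have Zb: "AE x in M. \<bar>Z x\<bar> \<le> C"
  proof eventually_elim
    case (elim x)
    then show ?case by (intro LIMSEQ_le_const2[OF tendsto_rabs]) auto
  qed
  have Zi: "integrable M Z" by (rule integrable_const_bound[of _ C]) (use Zb in auto)
  have "(\<lambda>i. \<integral>x. \<bar>E (F (r i)) X x - Z x\<bar> \<partial>M) \<longlonglongrightarrow> (\<integral>x. 0 \<partial>M)"
  proof (rule integral_dominated_convergence[where w = "\<lambda>_. 2 * C"])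
    show "AE x in M. (\<lambda>i. \<bar>E (F (r i)) X x - Z x\<bar>) \<longlonglongrightarrow> 0"
      using conv by eventually_elim (simp add: tendsto_rabs_zero_iff LIM_zero)
    show "AE x in M. norm \<bar>E (F (r i)) X x - Z x\<bar> \<le> 2 * C" for i
      using Zb bn[of "r i"] by eventually_elim auto
  qed auto
  then have sub: "(\<lambda>i. \<integral>x. \<bar>E (F (r i)) X x - Z x\<bar> \<partial>M) \<longlonglongrightarrow> 0" by simp
  have EZ: "AE x in M. E (inter_algebra F) X x = Z x"
  proof (rule Inf.real_cond_exp_charact)
    fix A assume A: "A \<in> sets (inter_algebra F)"
    then have AF: "A \<in> sets (F n)" for n by (simp add: sets_inter_algebra[OF subalg])
    have [measurable]: "A \<in> sets M" using A Inf.subalg by (auto simp: subalgebra_def)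
    have "(\<lambda>i. \<integral>x\<in>A. E (F (r i)) X x \<partial>M) \<longlonglongrightarrow> (\<integral>x\<in>A. Z x \<partial>M)"
      unfolding set_lebesgue_integral_def
    proof (rule integral_dominated_convergence[where w = "\<lambda>_. C"])
      show "AE x in M. (\<lambda>i. indicat_real A x *\<^sub>R E (F (r i)) X x) \<longlonglongrightarrow> indicat_real A x *\<^sub>R Z x"
        using conv by eventually_elim (intro tendsto_intros)
      show "AE x in M. norm (indicat_real A x *\<^sub>R E (F (r i)) X x) \<le> C" for i
        using bn[of "r i"] by eventually_elim (auto simp: indicator_def)
    qed auto
    moreover have "(\<integral>x\<in>A. E (F (r i)) X x \<partial>M) = (\<integral>x\<in>A. X x \<partial>M)" for i
      by (rule F.real_cond_exp_intA[symmetric]) (auto simp: X AF)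
    ultimately show "(\<integral>x\<in>A. X x \<partial>M) = (\<integral>x\<in>A. Z x \<partial>M)"
      by (simp add: LIMSEQ_const_iff)
  qed (auto simp: X Zi ZI)
  define b where "b n = (\<integral>x. \<bar>E (F n) X x - Z x\<bar> \<partial>M)" for n
  \<comment> \<open>\<open>E (F n)\<close> fixes \<open>Z\<close> and sends \<open>E (F m) X\<close>
    to \<open>E (F n) X\<close>, so this is its contraction property in L1.\<close>
  have "b n \<le> b m" if "m \<le> n" for m n
  proof -
    have 1: "AE x in M. E (F n) (\<lambda>x. E (F m) X x - Z x) x = E (F n) (E (F m) X) x - E (F n) Z x"
      by (rule F.real_cond_exp_diff) (auto simp: X Zi F.real_cond_exp_int)
    have 2: "AE x in M. E (F n) (E (F m) X) x = E (F n) X x"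
      using F.real_cond_exp_nested_subalg[OF subalg F_decseq[OF that] X] .
    have 3: "AE x in M. E (F n) Z x = Z x"
      by (rule F.real_cond_exp_F_meas) (auto simp: Zi ZF)
    have "b n = (\<integral>x. \<bar>E (F n) (\<lambda>x. E (F m) X x - Z x) x\<bar> \<partial>M)"
      unfolding b_def
    proof (rule integral_cong_AE)
      show "AE x in M. \<bar>E (F n) X x - Z x\<bar> = \<bar>E (F n) (\<lambda>x. E (F m) X x - Z x) x\<bar>"
        using 1 2 3 by eventually_elim simp
    qed auto
    also have "\<dots> \<le> b m"
      unfolding b_def by (rule F.real_cond_exp_L1_contraction) (auto simp: X Zi F.real_cond_exp_int)
    finally show ?thesis .
  qed
  then have "decseq b" by (simp add: decseq_def)
  moreover have "0 \<le> b n" for n by (simp add: b_def)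
  ultimately obtain L where L: "b \<longlonglongrightarrow> L" using decseq_convergent[of b 0] by metis
  have "L = 0"
    using LIMSEQ_unique[OF LIMSEQ_subseq_LIMSEQ[OF L r]] sub by (simp add: b_def o_def)
  moreover have "b = (\<lambda>n. \<integral>x. \<bar>E (F n) X x - E (inter_algebra F) X x\<bar> \<partial>M)"
    unfolding b_def
  proof (intro ext integral_cong_AE)
    fix n
    show "AE x in M. \<bar>E (F n) X x - Z x\<bar> = \<bar>E (F n) X x - E (inter_algebra F) X x\<bar>"
      using EZ by eventually_elim simp
  qed auto
  ultimately show ?thesis using L by simp
qed

text \<open>Truncation reduces to bounded X. The truncation error in L1 does not grow under any
  conditional expectation, so it stays below e/3 uniformly in n and also for the
  intersection.\<close>

lemma cond_exp_L1_tendsto: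
  assumes X: "integrable M X"
  shows "(\<lambda>n. \<integral>x. \<bar>E (F n) X x - E (inter_algebra F) X x\<bar> \<partial>M) \<longlonglongrightarrow> 0"
proof (rule LIMSEQ_I)
  fix e :: real assume e: "0 < e"
  note [measurable] = borel_measurable_integrable[OF X]
  define T where "T k x = max (- real k) (min (real k) (X x))" for k :: nat and x
  have [measurable]: "T k \<in> borel_measurable M" for k unfolding T_def by measurable
  have Tb: "\<bar>T k x\<bar> \<le> real k" for k x by (auto simp: T_def)
  have Ti: "integrable M (T k)" for k by (rule integrable_const_bound[of _ "real k"]) (auto simp: Tb)
  have "(\<lambda>k. \<integral>x. \<bar>X x - T k x\<bar> \<partial>M) \<longlonglongrightarrow> (\<integral>x. 0 \<partial>M)"
  proof (rule integral_dominated_convergence[where w = "\<lambda>x. \<bar>X x\<bar>"])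
    have "(\<lambda>k. \<bar>X x - T k x\<bar>) \<longlonglongrightarrow> 0" for x
    proof (rule tendsto_eventually)
      obtain N :: nat where N: "\<bar>X x\<bar> \<le> real N" using real_arch_simple by blast
      show "\<forall>\<^sub>F k in sequentially. \<bar>X x - T k x\<bar> = 0"
        using eventually_ge_at_top[of N]
      proof eventually_elim
        case (elim k)
        then have "\<bar>X x\<bar> \<le> real k" using N by simp
        then show ?case by (auto simp: T_def)
      qed
    qed
    then show "AE x in M. (\<lambda>k. \<bar>X x - T k x\<bar>) \<longlonglongrightarrow> 0" by simp
    show "AE x in M. norm \<bar>X x - T k x\<bar> \<le> \<bar>X x\<bar>" for k by (auto simp: T_def)
  qed (auto simp: X)
  then have "\<forall>\<^sub>F k in sequentially. (\<integral>x. \<bar>X x - T k x\<bar> \<partial>M) < e / 3"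
    by (rule order_tendstoD) (use e in simp)
  then obtain k where k: "(\<integral>x. \<bar>X x - T k x\<bar> \<partial>M) < e / 3"
    by (auto simp: eventually_sequentially)
  have "\<forall>\<^sub>F n in sequentially. (\<integral>x. \<bar>E (F n) (T k) x - E (inter_algebra F) (T k) x\<bar> \<partial>M) < e / 3"
    by (rule order_tendstoD[OF cond_exp_L1_tendsto_bounded[of "T k" "real k"]]) (use e in \<open>auto simp: Tb\<close>)
  then obtain N where N: "\<And>n. n \<ge> N \<Longrightarrow> (\<integral>x. \<bar>E (F n) (T k) x - E (inter_algebra F) (T k) x\<bar> \<partial>M) < e / 3"
    by (auto simp: eventually_sequentially)
  have close: "integrable M (\<lambda>x. \<bar>E G X x - E G (T k) x\<bar>)
      \<and> (\<integral>x. \<bar>E G X x - E G (T k) x\<bar> \<partial>M) < e / 3" if "subalgebra M G" for G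
  proof -
    interpret G: finite_measure_subalgebra M G by unfold_locales (rule that)
    have "AE x in M. E G (\<lambda>x. X x - T k x) x = E G X x - E G (T k) x"
      by (rule G.real_cond_exp_diff[OF X Ti])
    then have "(\<integral>x. \<bar>E G X x - E G (T k) x\<bar> \<partial>M) = (\<integral>x. \<bar>E G (\<lambda>x. X x - T k x) x\<bar> \<partial>M)"
      by (intro integral_cong_AE) auto
    also have "\<dots> \<le> (\<integral>x. \<bar>X x - T k x\<bar> \<partial>M)"
      by (rule G.real_cond_exp_L1_contraction) (auto simp: X Ti)
    finally show ?thesis using k X Ti by (auto simp: G.real_cond_exp_int)
  qed
  have "norm ((\<integral>x. \<bar>E (F n) X x - E (inter_algebra F) X x\<bar> \<partial>M) - 0) < e" if "n \<ge> N" for n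
  proof -
    let ?a = "\<lambda>x. \<bar>E (F n) X x - E (F n) (T k) x\<bar>"
    let ?b = "\<lambda>x. \<bar>E (F n) (T k) x - E (inter_algebra F) (T k) x\<bar>"
    let ?c = "\<lambda>x. \<bar>E (inter_algebra F) X x - E (inter_algebra F) (T k) x\<bar>"
    note a = close[OF subalg[of n]] and c = close[OF Inf.subalg]
    have b: "integrable M ?b"
      by (intro integrable_abs Bochner_Integration.integrable_diff F.real_cond_exp_int Inf.real_cond_exp_int Ti)
    have "(\<integral>x. \<bar>E (F n) X x - E (inter_algebra F) X x\<bar> \<partial>M) \<le> (\<integral>x. ?a x + ?b x + ?c x \<partial>M)"
    proof (rule integral_mono)
      show "integrable M (\<lambda>x. \<bar>E (F n) X x - E (inter_algebra F) X x\<bar>)"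
        by (intro integrable_abs Bochner_Integration.integrable_diff F.real_cond_exp_int Inf.real_cond_exp_int X)
      show "integrable M (\<lambda>x. ?a x + ?b x + ?c x)" using a b c by auto
    qed linarith
    also have "\<dots> = (\<integral>x. ?a x \<partial>M) + (\<integral>x. ?b x \<partial>M) + (\<integral>x. ?c x \<partial>M)"
      using a b c by simp
    also have "\<dots> < e" using a c N[OF that] by linarith
    finally show ?thesis by simp
  qed
  then show "\<exists>N. \<forall>n\<ge>N. norm ((\<integral>x. \<bar>E (F n) X x - E (inter_algebra F) X x\<bar> \<partial>M) - 0) < e" by blast
qed

end

section \<open>Integrals of functions of conditional expectations\<close>

lemma (in sigma_finite_subalgebra) real_cond_exp_01:
  assumes X: "integrable M X" and "AE x in M. 0 \<le> X x \<and> X x \<le> 1"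
  shows "AE x in M. 0 \<le> real_cond_exp M F X x \<and> real_cond_exp M F X x \<le> 1"
proof -
  have "AE x in M. X x \<ge> 0" "AE x in M. X x \<le> 1" using assms(2) by (eventually_elim, simp)+
  from real_cond_exp_ge_c[OF X this(1)] real_cond_exp_le_c[OF X this(2)]
  show ?thesis by eventually_elim simp
qed

text \<open>The set where the conditional expectation vanishes belongs to the sub-\<sigma>-algebra,
  so the nonnegative X has integral 0 over it.\<close>

lemma (in sigma_finite_subalgebra) real_cond_exp_eq_0D:
  assumes X: "integrable M X" and nn: "AE x in M. 0 \<le> X x"
  shows "AE x in M. real_cond_exp M F X x = 0 \<longrightarrow> X x = 0"
proof -
  define A where "A = {x \<in> space F. real_cond_exp M F X x = 0}"
  have A: "A \<in> sets F" unfolding A_def by measurable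
  then have [measurable]: "A \<in> sets M" using subalg by (auto simp: subalgebra_def)
  have "(\<integral>x. indicator A x * X x \<partial>M) = (\<integral>x. indicator A x * real_cond_exp M F X x \<partial>M)"
    using real_cond_exp_intA[OF X A] by (simp add: set_lebesgue_integral_def)
  also have "\<dots> = (\<integral>x. 0 \<partial>M)"
    by (rule Bochner_Integration.integral_cong) (auto simp: A_def indicator_def)
  finally have "(\<integral>x. indicator A x * X x \<partial>M) = 0" by simp
  moreover have "integrable M (\<lambda>x. indicator A x * X x)"
    using integrable_mult_indicator[OF \<open>A \<in> sets M\<close> X] by simp
  ultimately have "AE x in M. indicator A x * X x = 0"
    using nn by (subst (asm) integral_nonneg_eq_0_iff_AE) auto
  then show ?thesis
    using AE_space
  proof eventually_elim
    case (elim x)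
    then show ?case using subalg by (auto simp: A_def indicator_def subalgebra_def split: if_splits)
  qed
qed

lemma (in finite_measure_subalgebra) real_cond_exp_affine:
  assumes X: "integrable M X"
  shows "AE x in M. real_cond_exp M F (\<lambda>x. a + b * X x) x = a + b * real_cond_exp M F X x"
proof -
  have "AE x in M. real_cond_exp M F (\<lambda>x. a + b * X x) x
      = real_cond_exp M F (\<lambda>x. a) x + real_cond_exp M F (\<lambda>x. b * X x) x"
    by (rule real_cond_exp_add) (auto simp: X)
  moreover have "AE x in M. real_cond_exp M F (\<lambda>x. a) x = a"
    by (rule real_cond_exp_F_meas) auto
  moreover have "AE x in M. real_cond_exp M F (\<lambda>x. b * X x) x = b * real_cond_exp M F X x"
    by (rule real_cond_exp_cmult[OF X])
  ultimately show ?thesis by eventually_elim simp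
qed

lemma (in finite_measure_subalgebra) real_cond_exp_eq_1D:
  assumes X: "integrable M X" and le: "AE x in M. X x \<le> 1"
  shows "AE x in M. real_cond_exp M F X x = 1 \<longrightarrow> X x = 1"
proof -
  have "AE x in M. real_cond_exp M F (\<lambda>x. 1 + (-1) * X x) x = 0 \<longrightarrow> 1 + (-1) * X x = 0"
    using le by (intro real_cond_exp_eq_0D) (auto simp: X)
  with real_cond_exp_affine[OF X, of 1 "-1"] show ?thesis
    by eventually_elim simp
qed

text \<open>Convexity of \<open>h\<close> enters only through supporting lines on the open unit interval; at \<open>0\<close> only boundedness is used, and an infinite value at \<open>1\<close>
  is excluded by integrability.\<close>

lemma (in finite_measure_subalgebra) nn_jensen_tangents:
  fixes h :: "real \<Rightarrow> ennreal"
  assumes X [measurable]: "X \<in> borel_measurable M" and X01: "AE x in M. 0 \<le> X x \<and> X x \<le> 1"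
    and h [measurable]: "h \<in> borel_measurable borel"
    and ab: "continuous_on {0<..<1} a" "continuous_on {0<..<1} b"
    and below: "\<And>s t. \<lbrakk>0 < s; s < 1; 0 \<le> t; t \<le> 1\<rbrakk> \<Longrightarrow> ennreal (a s + b s * t) \<le> h t"
    and touch: "\<And>s. \<lbrakk>0 < s; s < 1\<rbrakk> \<Longrightarrow> h s \<le> ennreal (a s + b s * s)"
    and h0: "h 0 \<le> ennreal C" and C: "0 \<le> C" and h1: "h 1 = \<infinity>"
    and fin: "(\<integral>\<^sup>+x. h (X x) \<partial>M) < \<infinity>"
  shows "integrable M (\<lambda>x. C + enn2real (h (X x)))"
    and "AE x in M. h (real_cond_exp M F X x) \<le> ennreal (real_cond_exp M F (\<lambda>x. C + enn2real (h (X x))) x)"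
proof -
  have Xi: "integrable M X"
    by (rule integrable_const_bound[of _ 1]) (use X01 in auto)
  have hfin: "AE x in M. h (X x) \<noteq> \<infinity>"
    by (rule nn_integral_PInf_AE) (use fin in auto)
  have Yi: "integrable M (\<lambda>x. enn2real (h (X x)))"
  proof (rule integrableI_nonneg)
    have "(\<integral>\<^sup>+x. ennreal (enn2real (h (X x))) \<partial>M) = (\<integral>\<^sup>+x. h (X x) \<partial>M)"
      using hfin by (intro nn_integral_cong_AE) (auto simp: top.not_eq_extremum)
    then show "(\<integral>\<^sup>+x. ennreal (enn2real (h (X x))) \<partial>M) < \<infinity>" using fin by simp
  qed auto
  then show "integrable M (\<lambda>x. C + enn2real (h (X x)))" by simp
  let ?E = "real_cond_exp M F"
  have tan: "AE x in M. a s + b s * ?E X x \<le> ?E (\<lambda>x. enn2real (h (X x))) x" if s: "0 < s" "s < 1" for s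
  proof -
    have "AE x in M. ?E (\<lambda>x. a s + b s * X x) x \<le> ?E (\<lambda>x. enn2real (h (X x))) x"
    proof (rule real_cond_exp_mono)
      show "AE x in M. a s + b s * X x \<le> enn2real (h (X x))"
        using X01 hfin
      proof eventually_elim
        case (elim x)
        then have "ennreal (a s + b s * X x) \<le> h (X x)" using below[OF s] by auto
        then have "enn2real (ennreal (a s + b s * X x)) \<le> enn2real (h (X x))"
          using elim by (intro enn2real_mono) (auto simp: top.not_eq_extremum)
        \<comment> \<open>A supporting line may be negative, and \<open>ennreal\<close> then
          truncates it to 0; the real inequality survives because truncation only raises the
          value.\<close>
        moreover have "y \<le> enn2real (ennreal y)" for y
          by (cases "0 \<le> y") (auto simp: ennreal_neg)
        ultimately show ?case using order_trans by blast
      qed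
    qed (auto simp: Xi Yi)
    with real_cond_exp_affine[OF Xi, of "a s" "b s"] show ?thesis by eventually_elim simp
  qed
  \<comment> \<open>The exceptional null set depends on s, so only countably many supporting lines
    are used at once; continuity of a and b recovers the line at an arbitrary point.\<close>
  have tanQ: "AE x in M. \<forall>s\<in>\<rat> \<inter> {0<..<1}. a s + b s * ?E X x \<le> ?E (\<lambda>x. enn2real (h (X x))) x"
    using tan by (subst AE_ball_countable) (auto intro: countable_Int1 countable_rat)
  have "AE x in M. 0 \<le> ?E X x \<and> ?E X x \<le> 1" by (rule real_cond_exp_01[OF Xi X01])
  \<comment> \<open>Where the conditional expectation is 1, so is X, and h would be infinite
    there.\<close>
  moreover have "AE x in M. ?E X x \<noteq> 1"
  proof -
    have "AE x in M. X x \<le> 1" using X01 by eventually_elim simp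
    from real_cond_exp_eq_1D[OF Xi this] hfin show ?thesis
      by eventually_elim (use h1 in auto)
  qed
  moreover have "AE x in M. ?E (\<lambda>x. enn2real (h (X x))) x \<ge> 0"
    by (rule real_cond_exp_ge_c[OF Yi]) simp
  moreover note tanQ real_cond_exp_affine[OF Yi, of C 1, simplified]
  ultimately show "AE x in M. h (?E X x) \<le> ennreal (?E (\<lambda>x. C + enn2real (h (X x))) x)"
  proof eventually_elim
    case (elim x)
    define t y where "t = ?E X x" and "y = ?E (\<lambda>x. enn2real (h (X x))) x"
    have y: "0 \<le> y" using elim by (simp add: y_def)
    show ?case
    proof (cases "t = 0")
      case True
      \<comment> \<open>No supporting line is available at 0; the summand C in the dominating
        function is there for this case.\<close>
      have "h t \<le> ennreal (C + y)"
        using order_trans[OF h0 ennreal_leI[of C "C + y"]] y True by simp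
      then show ?thesis using elim by (simp add: t_def y_def)
    next
      case False
      then have t: "0 < t" "t < 1" using elim by (auto simp: t_def)
      have "a t + b t * t \<le> y"
      proof (rule ccontr)
        assume "\<not> ?thesis"
        moreover have "((\<lambda>s. a s + b s * t) \<longlongrightarrow> a t + b t * t) (at t)"
          using ab t by (intro tendsto_intros) (auto simp: continuous_on_eq_continuous_at isCont_def)
        ultimately have "\<forall>\<^sub>F s in at t. y < a s + b s * t"
          by (intro order_tendstoD) auto
        then obtain d where d: "d > 0" "\<And>s. s \<noteq> t \<Longrightarrow> dist s t < d \<Longrightarrow> y < a s + b s * t"
          unfolding eventually_at by auto
        obtain q where q: "q \<in> \<rat>" "max 0 (t - d) < q" "q < t"
          using Rats_dense_in_real[of "max 0 (t - d)" t] d t by auto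
        then have "y < a q + b q * t" using d by (auto simp: dist_real_def)
        moreover have "a q + b q * t \<le> y" using elim q t by (auto simp: t_def y_def)
        ultimately show False by simp
      qed
      then have "ennreal (a t + b t * t) \<le> ennreal (C + y)" using C by (intro ennreal_leI) simp
      with touch[OF t] have "h t \<le> ennreal (C + y)" by (rule order_trans)
      then show ?thesis using elim by (simp add: t_def y_def)
    qed
  qed
qed

context backward_filtration
begin

lemma cond_exp_01:
  assumes "integrable M X" "AE x in M. 0 \<le> X x \<and> X x \<le> 1"
  shows "AE x in M. 0 \<le> E (F n) X x \<and> E (F n) X x \<le> 1"
    and "AE x in M. 0 \<le> E (inter_algebra F) X x \<and> E (inter_algebra F) X x \<le> 1"
  by (rule F.real_cond_exp_01[OF assms] Inf.real_cond_exp_01[OF assms])+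

text \<open>The endpoints need no continuity: almost everywhere where the limit is \<open>0\<close> or \<open>1\<close>,
  the sequence is constant.\<close>

lemma cond_exp_subseq_tendsto:
  fixes h :: "real \<Rightarrow> ennreal" and r :: "nat \<Rightarrow> nat"
  assumes X: "integrable M X" and X01: "AE x in M. 0 \<le> X x \<and> X x \<le> 1"
    and h: "continuous_on {0<..<1} h" and r: "strict_mono r"
  shows "\<exists>s :: nat \<Rightarrow> nat. strict_mono s \<and>
    (AE x in M. (\<lambda>k. h (E (F (r (s k))) X x)) \<longlonglongrightarrow> h (E (inter_algebra F) X x))"
proof -
  have "(\<lambda>k. \<integral>x. norm (E (F (r k)) X x - E (inter_algebra F) X x) \<partial>M) \<longlonglongrightarrow> 0"
    using LIMSEQ_subseq_LIMSEQ[OF cond_exp_L1_tendsto[OF X] r] by (simp add: o_def)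
  then obtain s where s: "strict_mono s"
    and AE: "AE x in M. (\<lambda>k. E (F (r (s k))) X x - E (inter_algebra F) X x) \<longlonglongrightarrow> 0"
    using tendsto_L1_AE_subseq[of M "\<lambda>k x. E (F (r k)) X x - E (inter_algebra F) X x"]
      F.real_cond_exp_int(1)[OF X] Inf.real_cond_exp_int(1)[OF X] by auto
  have nested: "AE x in M. E (inter_algebra F) (E (F n) X) x = E (inter_algebra F) X x" for n
    using Inf.real_cond_exp_nested_subalg[OF subalg inter_subalg X] .
  \<comment> \<open>By the tower property the limit is a conditional expectation of the nonnegative
    \<open>E (F n) X\<close>, which therefore vanishes wherever the limit does.\<close>
  have "AE x in M. E (inter_algebra F) X x = 0 \<longrightarrow> E (F n) X x = 0" for n
    using Inf.real_cond_exp_eq_0D[OF F.real_cond_exp_int(1)[OF X, of n]] cond_exp_01(1)[OF X X01, of n]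
      nested[of n] by auto
  then have 0: "AE x in M. \<forall>n. E (inter_algebra F) X x = 0 \<longrightarrow> E (F n) X x = 0"
    unfolding AE_all_countable by blast
  have "AE x in M. E (inter_algebra F) X x = 1 \<longrightarrow> E (F n) X x = 1" for n
    using Inf.real_cond_exp_eq_1D[OF F.real_cond_exp_int(1)[OF X, of n]] cond_exp_01(1)[OF X X01, of n]
      nested[of n] by auto
  then have 1: "AE x in M. \<forall>n. E (inter_algebra F) X x = 1 \<longrightarrow> E (F n) X x = 1"
    unfolding AE_all_countable by blast
  from AE 0 1 cond_exp_01(2)[OF X X01]
  have "AE x in M. (\<lambda>k. h (E (F (r (s k))) X x)) \<longlonglongrightarrow> h (E (inter_algebra F) X x)"
  proof eventually_elim
    case (elim x)
    define t where "t = E (inter_algebra F) X x"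
    have lim: "(\<lambda>k. E (F (r (s k))) X x) \<longlonglongrightarrow> t"
      using elim(1) by (simp add: t_def LIM_zero_iff)
    consider "t = 0" | "t = 1" | "0 < t" "t < 1" using elim(4) by (fastforce simp: t_def)
    then have "(\<lambda>k. h (E (F (r (s k))) X x)) \<longlonglongrightarrow> h t"
    proof cases
      case 1
      then show ?thesis using elim(2) by (simp add: t_def)
    next
      case 2
      then show ?thesis using elim(3) by (simp add: t_def)
    next
      case 3
      then have "isCont h t" using h by (simp add: continuous_on_eq_continuous_at)
      then show ?thesis using lim by (rule isCont_tendsto_compose)
    qed
    then show ?case by (simp add: t_def)
  qed
  with s show ?thesis by blast
qed

text \<open>Since the dominating functions converge in \<open>L\<^sup>1\<close> to an integrable \<open>G\<close>, the integrands
  can be cut off at \<open>G\<close> with a vanishing error, and dominated convergence applies.\<close>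

lemma nn_integral_cond_exp_tendsto:
  fixes h :: "real \<Rightarrow> ennreal"
  assumes X: "integrable M X" and X01: "AE x in M. 0 \<le> X x \<and> X x \<le> 1"
    and h [measurable]: "h \<in> borel_measurable borel" and cont: "continuous_on {0<..<1} h"
    and Y: "integrable M Y"
    and bound: "\<And>n. m \<le> n \<Longrightarrow> AE x in M. h (E (F n) X x) \<le> ennreal (E (F n) Y x)"
    and bound_inter: "AE x in M. h (E (inter_algebra F) X x) \<le> ennreal (E (inter_algebra F) Y x)"
  shows "(\<lambda>n. \<integral>\<^sup>+x. h (E (F n) X x) \<partial>M) \<longlonglongrightarrow> (\<integral>\<^sup>+x. h (E (inter_algebra F) X x) \<partial>M)"
proof (rule tendsto_if_subseq_subseq)
  have [measurable]: "E (F n) Z \<in> borel_measurable M" "E (inter_algebra F) Z \<in> borel_measurable M" for n Z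
    by (rule borel_measurable_cond_exp2)+
  fix r :: "nat \<Rightarrow> nat" assume r: "strict_mono r"
  obtain s0 where s0: "strict_mono s0"
    and AE0: "AE x in M. (\<lambda>k. h (E (F (r (s0 k))) X x)) \<longlonglongrightarrow> h (E (inter_algebra F) X x)"
    using cond_exp_subseq_tendsto[OF X X01 cont r] by blast
  \<comment> \<open>The shift by m keeps every index \<open>r (s k)\<close> at least m, where
    \<open>bound\<close> is available.\<close>
  define s where "s k = s0 (k + m)" for k
  have s: "strict_mono s" using s0 by (simp add: s_def strict_mono_def)
  have AE: "AE x in M. (\<lambda>k. h (E (F (r (s k))) X x)) \<longlonglongrightarrow> h (E (inter_algebra F) X x)"
    using AE0 unfolding s_def by eventually_elim (rule LIMSEQ_ignore_initial_segment)
  have rs: "strict_mono (\<lambda>k. r (s k))" using r s by (simp add: strict_mono_def)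
  have ge: "m \<le> r (s k)" for k
  proof -
    have "m \<le> s k" using strict_mono_imp_increasing[OF s0, of "k + m"] by (simp add: s_def)
    also have "\<dots> \<le> r (s k)" by (rule strict_mono_imp_increasing[OF r])
    finally show ?thesis .
  qed
  define f where "f k x = h (E (F (r (s k))) X x)" for k x
  define f' where "f' x = h (E (inter_algebra F) X x)" for x
  define G where "G = E (inter_algebra F) Y"
  define e where "e k x = \<bar>E (F (r (s k))) Y x - G x\<bar>" for k x
  have [measurable]: "f k \<in> borel_measurable M" "f' \<in> borel_measurable M" "G \<in> borel_measurable M"
    "e k \<in> borel_measurable M" for k
    unfolding f_def f'_def G_def e_def by measurable
  have Gi: "integrable M G" unfolding G_def by (rule Inf.real_cond_exp_int(1)[OF Y])
  have ei: "integrable M (e k)" for k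
    unfolding e_def using Gi F.real_cond_exp_int(1)[OF Y] by simp
  have cut: "(\<lambda>k. \<integral>\<^sup>+x. min (f k x) (ennreal (G x)) \<partial>M) \<longlonglongrightarrow> (\<integral>\<^sup>+x. min (f' x) (ennreal (G x)) \<partial>M)"
  proof (rule nn_integral_dominated_convergence[where w = "\<lambda>x. ennreal \<bar>G x\<bar>"])
    show "(\<integral>\<^sup>+x. ennreal \<bar>G x\<bar> \<partial>M) < \<infinity>"
      using Gi unfolding integrable_iff_bounded by simp
    show "AE x in M. (\<lambda>k. min (f k x) (ennreal (G x))) \<longlonglongrightarrow> min (f' x) (ennreal (G x))"
      using AE by eventually_elim (auto simp: f_def f'_def intro!: tendsto_min)
    show "AE x in M. min (f k x) (ennreal (G x)) \<le> ennreal \<bar>G x\<bar>" for k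
      by (intro AE_I2 min.coboundedI2 ennreal_leI) simp
  qed auto
  have lim': "(\<integral>\<^sup>+x. min (f' x) (ennreal (G x)) \<partial>M) = (\<integral>\<^sup>+x. f' x \<partial>M)"
    using bound_inter by (intro nn_integral_cong_AE) (auto simp: f'_def G_def min_def)
  have "(\<lambda>k. \<integral>x. e k x \<partial>M) \<longlonglongrightarrow> 0"
    using LIMSEQ_subseq_LIMSEQ[OF cond_exp_L1_tendsto[OF Y] rs] by (simp add: o_def e_def G_def)
  then have "(\<lambda>k. ennreal (\<integral>x. e k x \<partial>M)) \<longlonglongrightarrow> ennreal 0" by (rule tendsto_ennrealI)
  moreover have "(\<integral>\<^sup>+x. ennreal (e k x) \<partial>M) = ennreal (\<integral>x. e k x \<partial>M)" for k
    by (rule nn_integral_eq_integral[OF ei]) (simp add: e_def)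
  ultimately have err: "(\<lambda>k. \<integral>\<^sup>+x. ennreal (e k x) \<partial>M) \<longlonglongrightarrow> 0" by simp
  have "(\<lambda>k. \<integral>\<^sup>+x. f k x \<partial>M) \<longlonglongrightarrow> (\<integral>\<^sup>+x. f' x \<partial>M)"
  proof (rule tendsto_sandwich)
    show "(\<lambda>k. \<integral>\<^sup>+x. min (f k x) (ennreal (G x)) \<partial>M) \<longlonglongrightarrow> (\<integral>\<^sup>+x. f' x \<partial>M)"
      using cut lim' by simp
    show "(\<lambda>k. (\<integral>\<^sup>+x. min (f k x) (ennreal (G x)) \<partial>M) + (\<integral>\<^sup>+x. ennreal (e k x) \<partial>M)) \<longlonglongrightarrow> (\<integral>\<^sup>+x. f' x \<partial>M)"
      using tendsto_add[OF cut err] lim' by simp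
    show "\<forall>\<^sub>F k in sequentially. (\<integral>\<^sup>+x. min (f k x) (ennreal (G x)) \<partial>M) \<le> (\<integral>\<^sup>+x. f k x \<partial>M)"
      by (intro always_eventually allI nn_integral_mono) simp
    show "\<forall>\<^sub>F k in sequentially. (\<integral>\<^sup>+x. f k x \<partial>M)
        \<le> (\<integral>\<^sup>+x. min (f k x) (ennreal (G x)) \<partial>M) + (\<integral>\<^sup>+x. ennreal (e k x) \<partial>M)"
    proof (intro always_eventually allI)
      fix k
      have "(\<integral>\<^sup>+x. f k x \<partial>M) \<le> (\<integral>\<^sup>+x. min (f k x) (ennreal (G x)) + ennreal (e k x) \<partial>M)"
      proof (rule nn_integral_mono_AE)
        show "AE x in M. f k x \<le> min (f k x) (ennreal (G x)) + ennreal (e k x)"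
          using bound[OF ge[of k]]
        proof eventually_elim
          case (elim x)
          \<comment> \<open>The maximum handles points where G is negative, which
            \<open>ennreal\<close> reads as 0.\<close>
          have "ennreal (E (F (r (s k))) Y x) \<le> ennreal (max 0 (G x) + e k x)"
            unfolding e_def by (rule ennreal_leI) linarith
          also have "\<dots> = ennreal (G x) + ennreal (e k x)"
            by (cases "0 \<le> G x") (auto simp: e_def ennreal_neg)
          finally have "f k x \<le> ennreal (G x) + ennreal (e k x)"
            using elim by (simp add: f_def)
          then show ?case by (auto simp: min_def)
        qed
      qed
      also have "\<dots> = (\<integral>\<^sup>+x. min (f k x) (ennreal (G x)) \<partial>M) + (\<integral>\<^sup>+x. ennreal (e k x) \<partial>M)"
        by (rule nn_integral_add) auto
      finally show "(\<integral>\<^sup>+x. f k x \<partial>M) \<le> (\<integral>\<^sup>+x. min (f k x) (ennreal (G x)) \<partial>M) + (\<integral>\<^sup>+x. ennreal (e k x) \<partial>M)" .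
    qed
  qed
  then show "\<exists>s. strict_mono s \<and> (\<lambda>k. \<integral>\<^sup>+x. h (E (F (r (s k))) X x) \<partial>M) \<longlonglongrightarrow> (\<integral>\<^sup>+x. h (E (inter_algebra F) X x) \<partial>M)"
    using s unfolding f_def f'_def by blast
qed

lemma nn_integral_cond_exp_tendsto_bounded:
  fixes h :: "real \<Rightarrow> ennreal"
  assumes X: "integrable M X" and X01: "AE x in M. 0 \<le> X x \<and> X x \<le> 1"
    and h: "h \<in> borel_measurable borel" and cont: "continuous_on {0<..<1} h"
    and le: "\<And>t. \<lbrakk>0 \<le> t; t \<le> 1\<rbrakk> \<Longrightarrow> h t \<le> ennreal C"
  shows "(\<lambda>n. \<integral>\<^sup>+x. h (E (F n) X x) \<partial>M) \<longlonglongrightarrow> (\<integral>\<^sup>+x. h (E (inter_algebra F) X x) \<partial>M)"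
proof (rule nn_integral_cond_exp_tendsto[OF X X01 h cont, where Y = "\<lambda>_. C" and m = 0])
  show "AE x in M. h (E (F n) X x) \<le> ennreal (E (F n) (\<lambda>_. C) x)" for n
  proof -
    have "AE x in M. E (F n) (\<lambda>_. C) x = C" by (rule F.real_cond_exp_F_meas) auto
    with cond_exp_01(1)[OF X X01, of n] show ?thesis by eventually_elim (simp add: le)
  qed
  have "AE x in M. E (inter_algebra F) (\<lambda>_. C) x = C" by (rule Inf.real_cond_exp_F_meas) auto
  with cond_exp_01(2)[OF X X01] show "AE x in M. h (E (inter_algebra F) X x) \<le> ennreal (E (inter_algebra F) (\<lambda>_. C) x)"
    by eventually_elim (simp add: le)
qed simp

text \<open>Finiteness at the single index m suffices: Jensen's inequality for
  \<open>E (F m) X\<close> and any \<open>A\<close> inside \<open>F m\<close>, together with the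
  tower property, bounds h(E[X | A]) by the conditional expectation of one fixed integrable
  \<open>?Y\<close>. This covers all later \<open>F n\<close> and the intersection at once.\<close>

lemma nn_integral_cond_exp_tendsto_convex:
  fixes h :: "real \<Rightarrow> ennreal"
  assumes X: "integrable M X" and X01: "AE x in M. 0 \<le> X x \<and> X x \<le> 1"
    and h [measurable]: "h \<in> borel_measurable borel" and cont: "continuous_on {0<..<1} h"
    and ab: "continuous_on {0<..<1} a" "continuous_on {0<..<1} b"
    and below: "\<And>s t. \<lbrakk>0 < s; s < 1; 0 \<le> t; t \<le> 1\<rbrakk> \<Longrightarrow> ennreal (a s + b s * t) \<le> h t"
    and touch: "\<And>s. \<lbrakk>0 < s; s < 1\<rbrakk> \<Longrightarrow> h s \<le> ennreal (a s + b s * s)"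
    and h0: "h 0 \<le> ennreal C" and C: "0 \<le> C" and h1: "h 1 = \<infinity>"
    and fin: "(\<integral>\<^sup>+x. h (E (F m) X x) \<partial>M) < \<infinity>"
  shows "(\<lambda>n. \<integral>\<^sup>+x. h (E (F n) X x) \<partial>M) \<longlonglongrightarrow> (\<integral>\<^sup>+x. h (E (inter_algebra F) X x) \<partial>M)"
proof -
  have [measurable]: "E (F m) X \<in> borel_measurable M" by (rule borel_measurable_cond_exp2)
  let ?Y = "\<lambda>x. C + enn2real (h (E (F m) X x))"
  have jensen: "integrable M ?Y"
    "AE x in M. h (E A X x) \<le> ennreal (E A ?Y x)"
    if "subalgebra M A" "subalgebra (F m) A" for A
  proof -
    interpret A: finite_measure_subalgebra M A by unfold_locales (rule that(1))
    note J = A.nn_jensen_tangents[OF _ cond_exp_01(1)[OF X X01] h ab below touch h0 C h1 fin]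
    show "integrable M ?Y" by (rule J(1)) auto
    have "AE x in M. h (E A (E (F m) X) x) \<le> ennreal (E A ?Y x)" by (rule J(2)) auto
    with A.real_cond_exp_nested_subalg[OF subalg that(2) X]
    show "AE x in M. h (E A X x) \<le> ennreal (E A ?Y x)" by eventually_elim simp
  qed
  show ?thesis
    by (rule nn_integral_cond_exp_tendsto[OF X X01 h cont, where Y = ?Y and m = m])
      (rule jensen Inf.subalg inter_subalg subalg F_decseq | assumption)+
qed

end

section \<open>Renyi integrands\<close>

text \<open>Fatou's lemma gives the lower bound, domination by the limit itself the upper one. The
  integral of g may be infinite, so dominated convergence would not do.\<close>

lemma nn_integral_tendsto_below:
  fixes f :: "nat \<Rightarrow> 'a \<Rightarrow> ennreal"
  assumes [measurable]: "\<And>k. f k \<in> borel_measurable M" "g \<in> borel_measurable M"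
    and le: "\<And>k. AE x in M. f k x \<le> g x" and lim: "AE x in M. (\<lambda>k. f k x) \<longlonglongrightarrow> g x"
  shows "(\<lambda>k. \<integral>\<^sup>+x. f k x \<partial>M) \<longlonglongrightarrow> (\<integral>\<^sup>+x. g x \<partial>M)"
proof (rule Liminf_eq_Limsup)
  have "(\<integral>\<^sup>+x. g x \<partial>M) = (\<integral>\<^sup>+x. liminf (\<lambda>k. f k x) \<partial>M)"
    using lim by (intro nn_integral_cong_AE, eventually_elim) (metis tendsto_iff_Liminf_eq_Limsup sequentially_bot)
  also have "\<dots> \<le> liminf (\<lambda>k. \<integral>\<^sup>+x. f k x \<partial>M)" by (rule nn_integral_liminf) simp
  finally have 1: "(\<integral>\<^sup>+x. g x \<partial>M) \<le> liminf (\<lambda>k. \<integral>\<^sup>+x. f k x \<partial>M)" .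
  have 2: "limsup (\<lambda>k. \<integral>\<^sup>+x. f k x \<partial>M) \<le> (\<integral>\<^sup>+x. g x \<partial>M)"
    by (rule Limsup_bounded) (intro always_eventually allI nn_integral_mono_AE le)
  have 3: "liminf (\<lambda>k. \<integral>\<^sup>+x. f k x \<partial>M) \<le> limsup (\<lambda>k. \<integral>\<^sup>+x. f k x \<partial>M)"
    by (intro Liminf_le_Limsup sequentially_bot)
  show "liminf (\<lambda>k. \<integral>\<^sup>+x. f k x \<partial>M) = (\<integral>\<^sup>+x. g x \<partial>M)"
    using 1 2 3 by order
  show "limsup (\<lambda>k. \<integral>\<^sup>+x. f k x \<partial>M) = (\<integral>\<^sup>+x. g x \<partial>M)"
    using 1 2 3 by order
qed simp

section \<open>The logarithm on the extended nonnegative reals\<close>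

lemma ln_ennreal_ennreal: "0 < x \<Longrightarrow> ln_ennreal (ennreal x) = ereal (ln x)"
  by (simp add: ln_ennreal_def)

lemma ln_ennreal_mono: "x \<le> y \<Longrightarrow> ln_ennreal x \<le> ln_ennreal y"
  by (cases x; cases y) (auto simp: ln_ennreal_def ennreal_eq_0_iff top_unique)

lemma surj_ln_ennreal: "surj ln_ennreal"
proof (rule surjI)
  show "ln_ennreal (case y of ereal r \<Rightarrow> ennreal (exp r) | PInfty \<Rightarrow> \<infinity> | MInfty \<Rightarrow> 0) = y" for y
    by (cases y) (simp_all add: ln_ennreal_def)
qed

text \<open>A monotone surjection between these order topologies is continuous, so the values 0 and
  infinity call for no separate treatment.\<close>

lemma tendsto_ln_ennreal:
  assumes "(f \<longlongrightarrow> x) G"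
  shows "((\<lambda>n. ln_ennreal (f n)) \<longlongrightarrow> ln_ennreal x) G"
proof -
  have "continuous_on UNIV ln_ennreal"
    by (rule continuous_onI_mono) (auto simp: surj_ln_ennreal intro: ln_ennreal_mono)
  then show ?thesis using assms by (auto intro: continuous_on_tendsto_compose)
qed

text \<open>This is p ln(p/q) + q - p with p = t and q = 1 - t. The correction q - p integrates to 0
  for probability densities and makes the expression nonnegative, so \<open>ennreal\<close>
  truncates nothing on [0,1). At t = 0 the logarithmic term is 0 and the value is 1.\<close>

definition KL_integrand :: "real \<Rightarrow> ennreal" where
  "KL_integrand t = (if t = 1 then \<infinity> else ennreal (t * ln (t / (1 - t)) + (1 - 2 * t)))"

text \<open>The integrand and the outer function with
  \<open>D\<^sub>\<alpha>(P\<parallel>Q) = renyi_outer \<alpha> (\<integral>renyi_inner \<alpha> p d(P + Q))\<close>, where \<open>p\<close> is the density of \<open>P\<close>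
  with respect to \<open>P + Q\<close>, so that \<open>1 - p\<close> is the density of \<open>Q\<close>.\<close>

definition renyi_inner :: "real \<Rightarrow> real \<Rightarrow> ennreal" where
  "renyi_inner \<alpha> t =
    (if \<alpha> = 0 then (if t = 0 then 0 else ennreal (1 - t))
     else if \<alpha> = 1 then KL_integrand t else renyi_integrand \<alpha> t (1 - t))"

definition renyi_outer :: "real \<Rightarrow> ennreal \<Rightarrow> ereal" where
  "renyi_outer \<alpha> y = (if \<alpha> = 1 then enn2ereal y else ereal (1 / (\<alpha> - 1)) * ln_ennreal y)"

lemma tendsto_renyi_outer:
  "(f \<longlongrightarrow> y) G \<Longrightarrow> ((\<lambda>n. renyi_outer \<alpha> (f n)) \<longlongrightarrow> renyi_outer \<alpha> y) G"
  unfolding renyi_outer_def by (auto intro: tendsto_ln_ennreal)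

text \<open>For \<alpha> > 1 the factor 1/(\<alpha> - 1) is positive, so an infinite integral forces
  an infinite divergence; below 1 the sign would turn it into minus infinity. This transfers the
  finiteness hypothesis to the integrals.\<close>

lemma renyi_outer_less_infinity:
  assumes "1 \<le> \<alpha>" "renyi_outer \<alpha> y < \<infinity>"
  shows "y < \<infinity>"
proof (rule ccontr)
  assume "\<not> y < \<infinity>"
  then have "y = \<infinity>" by (cases y) auto
  then show False using assms by (auto simp: renyi_outer_def ln_ennreal_def split: if_splits)
qed

lemma renyi_inner_measurable [measurable]: "renyi_inner \<alpha> \<in> borel_measurable borel"
  unfolding renyi_inner_def KL_integrand_def by measurable

lemma renyi_inner_less_1: "0 < \<alpha> \<Longrightarrow> \<alpha> < 1 \<Longrightarrow> renyi_inner \<alpha> t = ennreal (t powr \<alpha> * (1 - t) powr (1 - \<alpha>))"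
  by (simp add: renyi_inner_def renyi_integrand_def)

lemma continuous_on_renyi_inner:
  assumes "0 \<le> \<alpha>"
  shows "continuous_on {0<..<1} (renyi_inner \<alpha>)"
proof -
  consider "\<alpha> = 0" | "0 < \<alpha>" "\<alpha> < 1" | "\<alpha> = 1" | "1 < \<alpha>" using assms by linarith
  then show ?thesis
  proof cases
    case 1
    have "continuous_on {0<..<1::real} (\<lambda>t. ennreal (1 - t))"
      by (intro continuous_on_ennreal continuous_intros)
    then show ?thesis by (rule continuous_on_eq) (auto simp: renyi_inner_def 1)
  next
    case 2
    have "continuous_on {0<..<1} (\<lambda>t. ennreal (t powr \<alpha> * (1 - t) powr (1 - \<alpha>)))"
      by (intro continuous_on_ennreal continuous_intros) auto
    then show ?thesis by (rule continuous_on_eq) (simp add: renyi_inner_less_1 2)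
  next
    case 3
    have "continuous_on {0<..<1} (\<lambda>t::real. ennreal (t * ln (t / (1 - t)) + (1 - 2 * t)))"
      by (intro continuous_on_ennreal continuous_intros) auto
    then show ?thesis by (rule continuous_on_eq) (auto simp: renyi_inner_def KL_integrand_def 3)
  next
    case 4
    have "continuous_on {0<..<1} (\<lambda>t. ennreal (t powr \<alpha> / (1 - t) powr (\<alpha> - 1)))"
      by (intro continuous_on_ennreal continuous_intros) auto
    then show ?thesis
      by (rule continuous_on_eq) (use 4 in \<open>auto simp: renyi_inner_def renyi_integrand_def\<close>)
  qed
qed

lemma renyi_inner_le_1:
  assumes "0 \<le> \<alpha>" "\<alpha> < 1" "0 \<le> t" "t \<le> 1"
  shows "renyi_inner \<alpha> t \<le> ennreal 1"
proof (cases "\<alpha> = 0")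
  case True
  then show ?thesis using assms by (auto simp: renyi_inner_def intro: ennreal_leI)
next
  case False
  then have "t powr \<alpha> * (1 - t) powr (1 - \<alpha>) \<le> 1 * 1"
    using assms by (intro mult_mono powr_le1) auto
  then have "ennreal (t powr \<alpha> * (1 - t) powr (1 - \<alpha>)) \<le> ennreal 1" by (intro ennreal_leI) simp
  then show ?thesis using assms False by (simp add: renyi_inner_less_1)
qed

text \<open>Tangents in homogeneous form: \<open>p\<^sup>\<alpha> q\<^bsup>1-\<alpha>\<^esup> \<ge> \<alpha> u\<^bsup>\<alpha>-1\<^esup> p - (\<alpha>-1) u\<^sup>\<alpha> q\<close> for \<open>u > 0\<close>, with
  equality if \<open>u = p/q\<close>.\<close>

lemma powr_tangent:
  fixes \<alpha> u r :: real
  assumes "1 < \<alpha>" "0 < u" "0 \<le> r"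
  shows "\<alpha> * u powr (\<alpha> - 1) * r \<le> r powr \<alpha> + (\<alpha> - 1) * u powr \<alpha>"
proof -
  \<comment> \<open>Young's inequality for the conjugate exponents \<alpha> and \<alpha>/(\<alpha> -
    1).\<close>
  have "r * u powr (\<alpha> - 1) \<le> r powr \<alpha> / \<alpha> + (u powr (\<alpha> - 1)) powr (\<alpha> / (\<alpha> - 1)) / (\<alpha> / (\<alpha> - 1))"
    using assms by (intro Youngs_inequality) (auto simp: field_simps)
  also have "(u powr (\<alpha> - 1)) powr (\<alpha> / (\<alpha> - 1)) = u powr \<alpha>"
    using assms by (simp add: powr_powr)
  finally have "\<alpha> * (r * u powr (\<alpha> - 1)) \<le> \<alpha> * (r powr \<alpha> / \<alpha> + u powr \<alpha> / (\<alpha> / (\<alpha> - 1)))"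
    using assms by (intro mult_left_mono) auto
  also have "\<dots> = r powr \<alpha> + (\<alpha> - 1) * u powr \<alpha>" using assms by (simp add: field_simps)
  finally show ?thesis by (simp add: mult_ac)
qed

lemma renyi_tangent:
  assumes "1 < \<alpha>" "0 < u" "0 \<le> t" "t \<le> 1"
  shows "ennreal (- (\<alpha> - 1) * u powr \<alpha> + (\<alpha> * u powr (\<alpha> - 1) + (\<alpha> - 1) * u powr \<alpha>) * t) \<le> renyi_inner \<alpha> t"
proof (cases "t = 1")
  case True
  then show ?thesis using assms by (simp add: renyi_inner_def renyi_integrand_def)
next
  case False
  define r where "r = t / (1 - t)"
  have q: "0 < 1 - t" and r: "0 \<le> r" using assms False by (simp_all add: r_def)
  have t: "(1 - t) * r = t" using q by (simp add: r_def)
  have "(1 - t) * (\<alpha> * u powr (\<alpha> - 1) * r) \<le> (1 - t) * (r powr \<alpha> + (\<alpha> - 1) * u powr \<alpha>)"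
    using powr_tangent[OF assms(1,2) r] q by (intro mult_left_mono) auto
  moreover have "(1 - t) * (\<alpha> * u powr (\<alpha> - 1) * r) = \<alpha> * u powr (\<alpha> - 1) * ((1 - t) * r)"
    by (simp add: mult_ac)
  moreover have "(1 - t) * r powr \<alpha> = t powr \<alpha> / (1 - t) powr (\<alpha> - 1)"
    using q assms by (simp add: r_def powr_divide powr_diff field_simps)
  ultimately have "- (\<alpha> - 1) * u powr \<alpha> + (\<alpha> * u powr (\<alpha> - 1) + (\<alpha> - 1) * u powr \<alpha>) * t
      \<le> t powr \<alpha> / (1 - t) powr (\<alpha> - 1)"
    unfolding t by (simp add: algebra_simps)
  then show ?thesis
    using assms False by (simp add: renyi_inner_def renyi_integrand_def ennreal_leI)
qed

lemma renyi_tangent_eq: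
  assumes "1 < \<alpha>" "0 < s" "s < 1" and u: "u = s / (1 - s)"
  shows "renyi_inner \<alpha> s \<le> ennreal (- (\<alpha> - 1) * u powr \<alpha> + (\<alpha> * u powr (\<alpha> - 1) + (\<alpha> - 1) * u powr \<alpha>) * s)"
proof -
  have "0 < u" and s: "s = (1 - s) * u" using assms by (simp_all add: u)
  have up: "u * u powr (\<alpha> - 1) = u powr \<alpha>" using \<open>0 < u\<close> by (simp add: powr_diff)
  have "u powr (\<alpha> - 1) * s = (1 - s) * (u * u powr (\<alpha> - 1))"
    by (subst s) (simp add: mult_ac)
  then have 1: "u powr (\<alpha> - 1) * s = (1 - s) * u powr \<alpha>" unfolding up .
  have "s powr \<alpha> / (1 - s) powr (\<alpha> - 1) = (1 - s) * u powr \<alpha>"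
    using assms by (simp add: u powr_divide powr_diff field_simps)
  also have "\<dots> = - (\<alpha> - 1) * u powr \<alpha> + (\<alpha> * u powr (\<alpha> - 1) + (\<alpha> - 1) * u powr \<alpha>) * s"
    using 1 by algebra
  finally show ?thesis using assms by (simp add: renyi_inner_def renyi_integrand_def)
qed

text \<open>This is ln x \<le> x - 1 at x = u(1-t)/t, multiplied by t. Equality holds for x = 1,
  that is, when u is the odds t/(1-t).\<close>

lemma KL_tangent:
  assumes "0 < u" "0 \<le> t" "t \<le> 1"
  shows "ennreal (1 - u + (ln u + u - 1) * t) \<le> renyi_inner 1 t"
proof -
  consider "t = 0" | "t = 1" | "0 < t" "t < 1" using assms by linarith
  then show ?thesis
  proof cases
    case 3
    define x where "x = u / (t / (1 - t))"
    have x: "0 < x" using 3 assms by (simp add: x_def)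
    have "t * ln x \<le> t * (x - 1)" using ln_le_minus_one[OF x] 3 by (intro mult_left_mono) auto
    moreover have "t * x = (1 - t) * u" using 3 by (simp add: x_def)
    moreover have "ln x = ln u - ln (t / (1 - t))"
      unfolding x_def using 3 assms by (intro ln_divide_pos) auto
    ultimately have "1 - u + (ln u + u - 1) * t \<le> t * ln (t / (1 - t)) + (1 - 2 * t)"
      by (simp add: algebra_simps)
    then show ?thesis using 3 by (simp add: renyi_inner_def KL_integrand_def ennreal_leI)
  qed (use assms in \<open>auto simp: renyi_inner_def KL_integrand_def intro: ennreal_leI\<close>)
qed

lemma KL_tangent_eq:
  assumes "0 < s" "s < 1" and u: "u = s / (1 - s)"
  shows "renyi_inner 1 s \<le> ennreal (1 - u + (ln u + u - 1) * s)"
proof -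
  have "u = (1 + u) * s" using assms by (simp add: u field_simps)
  then have "s * ln u + (1 - 2 * s) = 1 - u + (ln u + u - 1) * s" by algebra
  moreover have "renyi_inner 1 s = ennreal (s * ln u + (1 - 2 * s))"
    using assms by (simp add: renyi_inner_def KL_integrand_def)
  ultimately show ?thesis by (simp only: order_refl)
qed

section \<open>Convergence of the integrals for each order\<close>

lemma (in backward_filtration) nn_integral_renyi_inner_tendsto:
  assumes X: "integrable M X" and X01: "AE x in M. 0 \<le> X x \<and> X x \<le> 1" and \<alpha>: "0 \<le> \<alpha>"
    and fin: "\<alpha> < 1 \<or> (\<exists>m. (\<integral>\<^sup>+x. renyi_inner \<alpha> (E (F m) X x) \<partial>M) < \<infinity>)"
  shows "(\<lambda>n. \<integral>\<^sup>+x. renyi_inner \<alpha> (E (F n) X x) \<partial>M)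
    \<longlonglongrightarrow> (\<integral>\<^sup>+x. renyi_inner \<alpha> (E (inter_algebra F) X x) \<partial>M)"
proof (cases "\<alpha> < 1")
  case True
  then show ?thesis
    using \<alpha> X X01 renyi_inner_le_1[OF \<alpha> True]
    by (intro nn_integral_cond_exp_tendsto_bounded[where C = 1] continuous_on_renyi_inner) auto
next
  case False
  then obtain m where m: "(\<integral>\<^sup>+x. renyi_inner \<alpha> (E (F m) X x) \<partial>M) < \<infinity>" using fin by blast
  \<comment> \<open>The odds p/q at p = s, the parameter for which the supporting line touches at
    s.\<close>
  define u where "u s = s / (1 - s)" for s :: real
  have u: "0 < u s" if "0 < s" "s < 1" for s using that by (simp add: u_def)
  have cu: "continuous_on {0<..<1} u" unfolding u_def by (intro continuous_intros) auto
  \<comment> \<open>C bounds the value at 0, which is 1 for \<alpha> = 1 and 0 for \<alpha> >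
    1.\<close>
  note conv = nn_integral_cond_exp_tendsto_convex[OF X X01 _ continuous_on_renyi_inner[OF \<alpha>] _ _ _ _ _ _ _ m, where C = 1]
  show ?thesis
  proof (cases "\<alpha> = 1")
    case True
    show ?thesis
    proof (rule conv)
      show "continuous_on {0<..<1} (\<lambda>s. 1 - u s)" "continuous_on {0<..<1} (\<lambda>s. ln (u s) + u s - 1)"
        using u by (intro continuous_intros cu; force)+
      show "ennreal (1 - u s + (ln (u s) + u s - 1) * t) \<le> renyi_inner \<alpha> t"
        if "0 < s" "s < 1" "0 \<le> t" "t \<le> 1" for s t
        using KL_tangent[OF u that(3,4)] that by (simp add: True)
      show "renyi_inner \<alpha> s \<le> ennreal (1 - u s + (ln (u s) + u s - 1) * s)" if "0 < s" "s < 1" for s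
        unfolding True using that by (rule KL_tangent_eq) (simp add: u_def)
    qed (auto simp: True renyi_inner_def KL_integrand_def)
  next
    case ne: False
    then have gt: "1 < \<alpha>" using False by simp
    show ?thesis
    proof (rule conv)
      show "continuous_on {0<..<1} (\<lambda>s. - (\<alpha> - 1) * u s powr \<alpha>)"
        "continuous_on {0<..<1} (\<lambda>s. \<alpha> * u s powr (\<alpha> - 1) + (\<alpha> - 1) * u s powr \<alpha>)"
        using u by (intro continuous_intros cu; force)+
      show "ennreal (- (\<alpha> - 1) * u s powr \<alpha> + (\<alpha> * u s powr (\<alpha> - 1) + (\<alpha> - 1) * u s powr \<alpha>) * t) \<le> renyi_inner \<alpha> t"
        if "0 < s" "s < 1" "0 \<le> t" "t \<le> 1" for s t
        using renyi_tangent[OF gt u that(3,4)] that by simp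
      show "renyi_inner \<alpha> s \<le> ennreal (- (\<alpha> - 1) * u s powr \<alpha> + (\<alpha> * u s powr (\<alpha> - 1) + (\<alpha> - 1) * u s powr \<alpha>) * s)"
        if "0 < s" "s < 1" for s
        using gt that by (rule renyi_tangent_eq) (simp add: u_def)
    qed (use gt in \<open>auto simp: renyi_inner_def renyi_integrand_def\<close>)
  qed
qed

section \<open>The orders 0 and 1 as limits in the order\<close>

lemma (in finite_measure) tendsto_renyi_order_0:
  assumes [measurable]: "X \<in> borel_measurable M" and X01: "AE x in M. 0 \<le> X x \<and> X x \<le> 1"
  shows "((\<lambda>\<beta>. renyi_outer \<beta> (\<integral>\<^sup>+x. renyi_inner \<beta> (X x) \<partial>M))
    \<longlongrightarrow> renyi_outer 0 (\<integral>\<^sup>+x. renyi_inner 0 (X x) \<partial>M)) (at_right 0)"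
proof (rule tendsto_at_right_sequentially[of 0 1])
  fix S :: "nat \<Rightarrow> real"
  assume S: "\<And>n. 0 < S n" "\<And>n. S n < 1" and lim: "S \<longlonglongrightarrow> 0"
  have "(\<lambda>k. \<integral>\<^sup>+x. renyi_inner (S k) (X x) \<partial>M) \<longlonglongrightarrow> (\<integral>\<^sup>+x. renyi_inner 0 (X x) \<partial>M)"
  proof (rule nn_integral_dominated_convergence[where w = "\<lambda>_. 1"])
    show "AE x in M. renyi_inner (S k) (X x) \<le> 1" for k
      using X01
    proof eventually_elim
      case (elim x)
      then show ?case using renyi_inner_le_1[of "S k" "X x"] S[of k] by simp
    qed
    show "AE x in M. (\<lambda>k. renyi_inner (S k) (X x)) \<longlonglongrightarrow> renyi_inner 0 (X x)"
      using X01
    proof eventually_elim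
      case (elim x)
      have S': "(\<lambda>k. renyi_inner (S k) (X x)) = (\<lambda>k. ennreal (X x powr S k * (1 - X x) powr (1 - S k)))"
        by (rule ext) (simp add: renyi_inner_less_1 S)
      consider "X x = 0" | "X x = 1" | "0 < X x" "X x < 1" using elim by linarith
      then show ?case
      proof cases
        \<comment> \<open>Every positive power vanishes at 0, so the limit is 0 and not 1 - t; this
          is the jump built into \<open>renyi_inner 0\<close>.\<close>
        case 1
        then show ?thesis unfolding S' by (simp add: renyi_inner_def)
      next
        case 2
        then show ?thesis unfolding S' by (simp add: renyi_inner_def)
      next
        case 3
        have "(\<lambda>k. X x powr S k * (1 - X x) powr (1 - S k)) \<longlonglongrightarrow> X x powr 0 * (1 - X x) powr (1 - 0)"
          using 3 by (intro tendsto_intros lim) auto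
        then show ?thesis unfolding S' using 3 by (auto simp: renyi_inner_def intro: tendsto_ennrealI)
      qed
    qed
    show "(\<integral>\<^sup>+x. 1 \<partial>M) < \<infinity>" by (simp add: less_top[symmetric])
  qed auto
  then have "(\<lambda>k. ln_ennreal (\<integral>\<^sup>+x. renyi_inner (S k) (X x) \<partial>M)) \<longlonglongrightarrow> ln_ennreal (\<integral>\<^sup>+x. renyi_inner 0 (X x) \<partial>M)"
    by (rule tendsto_ln_ennreal)
  moreover have "(\<lambda>k. ereal (1 / (S k - 1))) \<longlonglongrightarrow> ereal (1 / (0 - 1))"
    by (intro tendsto_intros lim) auto
  \<comment> \<open>The prefactor tends to -1, which is finite and nonzero, so the product converges
    even when the logarithm has an infinite limit.\<close>
  ultimately have "(\<lambda>k. ereal (1 / (S k - 1)) * ln_ennreal (\<integral>\<^sup>+x. renyi_inner (S k) (X x) \<partial>M))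
      \<longlonglongrightarrow> ereal (1 / (0 - 1)) * ln_ennreal (\<integral>\<^sup>+x. renyi_inner 0 (X x) \<partial>M)"
    by (intro tendsto_mult_ereal) auto
  moreover have "S k \<noteq> 1" for k using S[of k] by simp
  ultimately show "(\<lambda>k. renyi_outer (S k) (\<integral>\<^sup>+x. renyi_inner (S k) (X x) \<partial>M))
      \<longlonglongrightarrow> renyi_outer 0 (\<integral>\<^sup>+x. renyi_inner 0 (X x) \<partial>M)"
    by (simp add: renyi_outer_def)
qed simp


text \<open>As \<open>\<integral>p = \<integral>q = 1\<close>, the quantity \<open>(1 - \<integral>p\<^sup>\<beta>q\<^bsup>1-\<beta>\<^esup>) / (1 - \<beta>)\<close> is the integral of the following
  nonnegative function, which stays below the Kullback--Leibler integrand and tends to it as \<open>\<beta> \<up> 1\<close>.\<close>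

definition hellinger_gap :: "real \<Rightarrow> real \<Rightarrow> real" where
  "hellinger_gap \<beta> t = (\<beta> * t + (1 - \<beta>) * (1 - t) - t powr \<beta> * (1 - t) powr (1 - \<beta>)) / (1 - \<beta>)"

lemma hellinger_gap_nonneg:
  assumes "0 < \<beta>" "\<beta> < 1" "0 \<le> t" "t \<le> 1"
  shows "0 \<le> hellinger_gap \<beta> t"
proof (cases "t = 0 \<or> t = 1")
  case True
  then show ?thesis using assms by (auto simp: hellinger_gap_def)
next
  case False
  then show ?thesis
    using Youngs_inequality_0[of \<beta> "1 - \<beta>" t "1 - t"] assms by (simp add: hellinger_gap_def)
qed

text \<open>Factoring t out of the product of powers leaves (1 - exp(-x v))/x with x = 1 - \<beta>
  and v the logarithm of the odds: the difference quotient of -exp(-x v) at 0. It is at most v and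
  tends to v, which yields \<open>hellinger_gap_le_KL\<close> and
  \<open>hellinger_gap_tendsto_KL\<close>.\<close>

lemma hellinger_gap_exp:
  assumes "0 < \<beta>" "\<beta> < 1" "0 < t" "t < 1"
  shows "hellinger_gap \<beta> t = 1 - 2 * t + t * ((1 - exp (- ((1 - \<beta>) * ln (t / (1 - t))))) / (1 - \<beta>))"
proof -
  define x where "x = 1 - \<beta>"
  have x: "0 < x" and \<beta>: "\<beta> = 1 - x" using assms by (simp_all add: x_def)
  have "t powr \<beta> * (1 - t) powr (1 - \<beta>) = exp (\<beta> * ln t + (1 - \<beta>) * ln (1 - t))"
    using assms by (simp add: powr_def exp_add)
  also have "\<beta> * ln t + (1 - \<beta>) * ln (1 - t) = ln t + - ((1 - \<beta>) * ln (t / (1 - t)))"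
    using assms by (simp add: ln_divide_pos algebra_simps)
  also have "exp \<dots> = t * exp (- ((1 - \<beta>) * ln (t / (1 - t))))"
    using assms by (simp only: exp_add exp_ln)
  finally have "hellinger_gap \<beta> t = (\<beta> * t + (1 - \<beta>) * (1 - t) - t * exp (- ((1 - \<beta>) * ln (t / (1 - t))))) / (1 - \<beta>)"
    by (simp add: hellinger_gap_def)
  also have "\<dots> = (x * (1 - 2 * t) + t * (1 - exp (- (x * ln (t / (1 - t)))))) / x"
    unfolding \<beta> by (simp add: algebra_simps)
  also have "\<dots> = 1 - 2 * t + t * ((1 - exp (- (x * ln (t / (1 - t))))) / x)"
    using x by (simp add: add_divide_distrib)
  finally show ?thesis by (simp add: x_def)
qed

lemma hellinger_gap_le_KL:
  assumes "0 < \<beta>" "\<beta> < 1" "0 \<le> t" "t \<le> 1"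
  shows "ennreal (hellinger_gap \<beta> t) \<le> renyi_inner 1 t"
proof -
  consider "t = 0" | "t = 1" | "0 < t" "t < 1" using assms by linarith
  then show ?thesis
  proof cases
    case 3
    let ?u = "ln (t / (1 - t))"
    have "1 - exp (- ((1 - \<beta>) * ?u)) \<le> ?u * (1 - \<beta>)"
      using exp_ge_add_one_self[of "- ((1 - \<beta>) * ?u)"] by (simp add: mult.commute)
    then have "(1 - exp (- ((1 - \<beta>) * ?u))) / (1 - \<beta>) \<le> ?u"
      using assms by (simp add: pos_divide_le_eq)
    then have "t * ((1 - exp (- ((1 - \<beta>) * ?u))) / (1 - \<beta>)) \<le> t * ?u"
      using 3 by (intro mult_left_mono) auto
    then show ?thesis
      using 3 assms by (simp add: hellinger_gap_exp renyi_inner_def KL_integrand_def ennreal_leI)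
  qed (use assms in \<open>auto simp: hellinger_gap_def renyi_inner_def KL_integrand_def\<close>)
qed

lemma hellinger_gap_tendsto_KL:
  assumes S: "\<And>k. 0 < S k" "\<And>k. S k < 1" and lim: "S \<longlonglongrightarrow> 1" and t: "0 \<le> t" "t \<le> 1"
  shows "(\<lambda>k. ennreal (hellinger_gap (S k) t)) \<longlonglongrightarrow> renyi_inner 1 t"
proof -
  have lim0: "(\<lambda>k. 1 - S k) \<longlonglongrightarrow> 0" using tendsto_diff[OF tendsto_const[of 1] lim] by simp
  have S1: "1 - S k \<noteq> 0" for k using S(2)[of k] by simp
  consider "t = 0" | "t = 1" | "0 < t" "t < 1" using t by linarith
  then show ?thesis
  proof cases
    case 1
    have "hellinger_gap (S k) t = 1" for k using S1[of k] by (simp add: 1 hellinger_gap_def)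
    then show ?thesis by (simp add: 1 renyi_inner_def KL_integrand_def)
  next
    \<comment> \<open>At t = 1 the gap is \<beta>/(1 - \<beta>), which grows to infinity.\<close>
    case 2
    have "filterlim (\<lambda>k. inverse (1 - S k)) at_top sequentially"
      using S(2) by (intro filterlim_inverse_at_top lim0) simp
    then have "filterlim (\<lambda>k. S k * inverse (1 - S k)) at_top sequentially"
      by (rule filterlim_tendsto_pos_mult_at_top[OF lim, rotated]) simp
    then have "(\<lambda>k. ennreal (S k * inverse (1 - S k))) \<longlonglongrightarrow> top"
      by (simp only: ennreal_tendsto_top_eq_at_top)
    then show ?thesis
      by (simp add: 2 renyi_inner_def KL_integrand_def hellinger_gap_def divide_inverse)
  next
    case 3
    let ?u = "ln (t / (1 - t))"
    have "((\<lambda>x. - exp (- (x * ?u))) has_field_derivative ?u) (at 0)"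
      by (auto intro!: derivative_eq_intros)
    then have "((\<lambda>x. (1 - exp (- (x * ?u))) / x) \<longlongrightarrow> ?u) (at 0)"
      by (simp add: DERIV_def)
    moreover have "filterlim (\<lambda>k. 1 - S k) (at 0) sequentially"
      using S1 by (intro filterlim_atI lim0) simp
    ultimately have "(\<lambda>k. (1 - exp (- ((1 - S k) * ?u))) / (1 - S k)) \<longlonglongrightarrow> ?u"
      by (rule filterlim_compose)
    then have "(\<lambda>k. 1 - 2 * t + t * ((1 - exp (- ((1 - S k) * ?u))) / (1 - S k))) \<longlonglongrightarrow> 1 - 2 * t + t * ?u"
      by (intro tendsto_intros)
    then have "(\<lambda>k. hellinger_gap (S k) t) \<longlonglongrightarrow> 1 - 2 * t + t * ?u"
      using 3 S by (simp add: hellinger_gap_exp)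
    then show ?thesis
      using 3 by (auto simp: renyi_inner_def KL_integrand_def add.commute intro: tendsto_ennrealI)
  qed
qed

text \<open>The bounds \<open>1 - h \<le> - ln h \<le> (1 - h) / h\<close>, with \<open>I = (1 - h) / (1 - \<beta>)\<close>.\<close>

lemma renyi_outer_bounds:
  assumes \<beta>: "0 < \<beta>" "\<beta> < 1" and eq: "H + ennreal (1 - \<beta>) * I = 1"
  shows "enn2ereal I \<le> renyi_outer \<beta> H"
    and "(1 - \<beta>) * enn2real I < 1 \<Longrightarrow> renyi_outer \<beta> H \<le> ereal (enn2real I / (1 - (1 - \<beta>) * enn2real I))"
proof -
  have "I \<noteq> \<infinity>" "H \<noteq> \<infinity>" using eq \<beta> by (auto simp: ennreal_mult_top)
  then obtain i h where i: "0 \<le> i" "I = ennreal i" and h0: "0 \<le> h" "H = ennreal h"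
    by (cases I; cases H) auto
  have "ennreal (h + (1 - \<beta>) * i) = ennreal 1"
    using eq \<beta> i h0 by (simp add: ennreal_mult)
  then have hi: "h + (1 - \<beta>) * i = 1"
    using \<beta> i h0 by (subst (asm) ennreal_inj) auto
  then have i': "i = (1 - h) / (1 - \<beta>)" using \<beta> by (simp add: field_simps)
  have neg: "1 / (\<beta> - 1) = - (1 / (1 - \<beta>))" using \<beta> by (simp add: field_simps)
  have val: "renyi_outer \<beta> H = ereal (- ln h / (1 - \<beta>))" if "0 < h"
    using that \<beta> unfolding renyi_outer_def h0(2) neg by (simp add: ln_ennreal_ennreal)
  show "enn2ereal I \<le> renyi_outer \<beta> H"
  proof (cases "h = 0")
    case True
    have "1 / (\<beta> - 1) < 0" using \<beta> by simp
    then have "renyi_outer \<beta> H = \<infinity>"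
      using \<beta> unfolding renyi_outer_def h0(2) True by (auto simp: ln_ennreal_def)
    then show ?thesis by simp
  next
    case False
    then have "(1 - h) / (1 - \<beta>) \<le> - ln h / (1 - \<beta>)"
      using ln_le_minus_one[of h] h0 \<beta> by (intro divide_right_mono) auto
    then have "ereal i \<le> ereal (- ln h / (1 - \<beta>))" unfolding i' by simp
    moreover have "0 < h" using False h0(1) by simp
    ultimately show ?thesis using i by (simp only: val enn2ereal_ennreal)
  qed
  show "renyi_outer \<beta> H \<le> ereal (enn2real I / (1 - (1 - \<beta>) * enn2real I))" if "(1 - \<beta>) * enn2real I < 1"
  proof -
    have h: "0 < h" "1 - (1 - \<beta>) * i = h" using that hi i by simp_all
    have "- ln h \<le> 1 / h - 1"
      using ln_le_minus_one[of "1 / h"] h(1) by (simp add: ln_div)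
    then have "- ln h / (1 - \<beta>) \<le> (1 / h - 1) / (1 - \<beta>)"
      using \<beta> by (intro divide_right_mono) auto
    also have "\<dots> = i / h" unfolding i' using h(1) \<beta> by (simp add: field_simps)
    finally have "ereal (- ln h / (1 - \<beta>)) \<le> ereal (i / h)" by simp
    then show ?thesis unfolding val[OF h(1)] i(2) enn2real_ennreal[OF i(1)] h(2) .
  qed
qed

text \<open>The form is additive because subtraction in \<open>ennreal\<close> truncates. Pointwise
  the two terms add up to \<beta> p + (1 - \<beta>) q, whose integral is 1.\<close>

lemma (in finite_measure) nn_integral_hellinger_gap:
  assumes [measurable]: "X \<in> borel_measurable M" and X01: "AE x in M. 0 \<le> X x \<and> X x \<le> 1"
    and p: "(\<integral>\<^sup>+x. ennreal (X x) \<partial>M) = 1" and q: "(\<integral>\<^sup>+x. ennreal (1 - X x) \<partial>M) = 1"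
    and \<beta>: "0 < \<beta>" "\<beta> < 1"
  shows "(\<integral>\<^sup>+x. renyi_inner \<beta> (X x) \<partial>M) + ennreal (1 - \<beta>) * (\<integral>\<^sup>+x. ennreal (hellinger_gap \<beta> (X x)) \<partial>M) = 1"
proof -
  have [measurable]: "hellinger_gap \<beta> \<in> borel_measurable borel" unfolding hellinger_gap_def by measurable
  have "(\<integral>\<^sup>+x. renyi_inner \<beta> (X x) \<partial>M) + ennreal (1 - \<beta>) * (\<integral>\<^sup>+x. ennreal (hellinger_gap \<beta> (X x)) \<partial>M)
      = (\<integral>\<^sup>+x. renyi_inner \<beta> (X x) + ennreal (1 - \<beta>) * ennreal (hellinger_gap \<beta> (X x)) \<partial>M)"
    by (simp add: nn_integral_add nn_integral_cmult)
  also have "\<dots> = (\<integral>\<^sup>+x. ennreal \<beta> * ennreal (X x) + ennreal (1 - \<beta>) * ennreal (1 - X x) \<partial>M)"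
  proof (rule nn_integral_cong_AE)
    show "AE x in M. renyi_inner \<beta> (X x) + ennreal (1 - \<beta>) * ennreal (hellinger_gap \<beta> (X x))
        = ennreal \<beta> * ennreal (X x) + ennreal (1 - \<beta>) * ennreal (1 - X x)"
      using X01
    proof eventually_elim
      case (elim x)
      define t where "t = X x"
      have t: "0 \<le> t" "t \<le> 1" using elim by (simp_all add: t_def)
      have "t powr \<beta> * (1 - t) powr (1 - \<beta>) + (1 - \<beta>) * hellinger_gap \<beta> t = \<beta> * t + (1 - \<beta>) * (1 - t)"
        using \<beta> by (simp add: hellinger_gap_def)
      then have "ennreal (t powr \<beta> * (1 - t) powr (1 - \<beta>)) + ennreal ((1 - \<beta>) * hellinger_gap \<beta> t)
          = ennreal (\<beta> * t) + ennreal ((1 - \<beta>) * (1 - t))"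
        using \<beta> t hellinger_gap_nonneg[OF \<beta> t] by (simp del: ennreal_plus flip: ennreal_plus)
      then show ?case
        using \<beta> t hellinger_gap_nonneg[OF \<beta> t]
        by (simp add: renyi_inner_less_1 ennreal_mult t_def[symmetric])
    qed
  qed
  also have "\<dots> = ennreal \<beta> * 1 + ennreal (1 - \<beta>) * 1"
    by (simp add: nn_integral_add nn_integral_cmult p q)
  also have "\<dots> = 1" using \<beta> by (simp flip: ennreal_plus)
  finally show ?thesis .
qed

text \<open>\<open>renyi_outer_bounds\<close> squeezes the divergence between I and I/(1 - (1 -
  \<beta>) I), where I tends to the Kullback-Leibler integral. If that is infinite, the lower bound
  alone decides; otherwise (1 - \<beta>) I tends to 0 and the two bounds meet.\<close>

lemma (in finite_measure) tendsto_renyi_order_1: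
  assumes [measurable]: "X \<in> borel_measurable M" and X01: "AE x in M. 0 \<le> X x \<and> X x \<le> 1"
    and p: "(\<integral>\<^sup>+x. ennreal (X x) \<partial>M) = 1" and q: "(\<integral>\<^sup>+x. ennreal (1 - X x) \<partial>M) = 1"
  shows "((\<lambda>\<beta>. renyi_outer \<beta> (\<integral>\<^sup>+x. renyi_inner \<beta> (X x) \<partial>M))
    \<longlongrightarrow> renyi_outer 1 (\<integral>\<^sup>+x. renyi_inner 1 (X x) \<partial>M)) (at_left 1)"
proof (rule tendsto_at_left_sequentially[of 0 1])
  fix S :: "nat \<Rightarrow> real"
  assume S: "\<And>n. S n < 1" "\<And>n. 0 < S n" and lim: "S \<longlonglongrightarrow> 1"
  have [measurable]: "hellinger_gap \<beta> \<in> borel_measurable borel" for \<beta>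
    unfolding hellinger_gap_def by measurable
  define I where "I k = (\<integral>\<^sup>+x. ennreal (hellinger_gap (S k) (X x)) \<partial>M)" for k
  define K where "K = (\<integral>\<^sup>+x. renyi_inner 1 (X x) \<partial>M)"
  let ?D = "\<lambda>k. renyi_outer (S k) (\<integral>\<^sup>+x. renyi_inner (S k) (X x) \<partial>M)"
  have IK: "I \<longlonglongrightarrow> K"
    unfolding I_def K_def
  proof (rule nn_integral_tendsto_below)
    show "AE x in M. ennreal (hellinger_gap (S k) (X x)) \<le> renyi_inner 1 (X x)" for k
      using X01 by eventually_elim (auto intro!: hellinger_gap_le_KL S)
    show "AE x in M. (\<lambda>k. ennreal (hellinger_gap (S k) (X x))) \<longlonglongrightarrow> renyi_inner 1 (X x)"
      using X01 by eventually_elim (auto intro!: hellinger_gap_tendsto_KL S lim)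
  qed auto
  note eq = nn_integral_hellinger_gap[OF assms(1) X01 p q S(2,1), folded I_def]
  have low: "\<forall>\<^sub>F k in sequentially. enn2ereal (I k) \<le> ?D k"
    using renyi_outer_bounds(1)[OF S(2,1) eq] by (intro always_eventually) blast
  have IK': "(\<lambda>k. enn2ereal (I k)) \<longlonglongrightarrow> enn2ereal K" using IK by (rule tendsto_enn2erealI)
  have "?D \<longlonglongrightarrow> enn2ereal K"
  proof (cases "K = \<infinity>")
    case True
    show ?thesis
      by (rule tendsto_sandwich[OF low _ IK', where h = "\<lambda>_. \<infinity>"]) (auto simp: True)
  next
    case False
    then obtain \<kappa> where \<kappa>: "0 \<le> \<kappa>" "K = ennreal \<kappa>" by (cases K) auto
    have i: "(\<lambda>k. enn2real (I k)) \<longlonglongrightarrow> \<kappa>" using IK \<kappa> by (intro tendsto_enn2real) auto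
    have "(\<lambda>k. (1 - S k) * enn2real (I k)) \<longlonglongrightarrow> (1 - 1) * \<kappa>" by (intro tendsto_intros i lim)
    then have z: "(\<lambda>k. (1 - S k) * enn2real (I k)) \<longlonglongrightarrow> 0" by simp
    then have "\<forall>\<^sub>F k in sequentially. (1 - S k) * enn2real (I k) < 1" by (rule order_tendstoD) simp
    then have up: "\<forall>\<^sub>F k in sequentially. ?D k \<le> ereal (enn2real (I k) / (1 - (1 - S k) * enn2real (I k)))"
      by eventually_elim (rule renyi_outer_bounds(2)[OF S(2,1) eq])
    have "(\<lambda>k. enn2real (I k) / (1 - (1 - S k) * enn2real (I k))) \<longlonglongrightarrow> \<kappa> / (1 - 0)"
      by (intro tendsto_intros i z) simp
    then have "(\<lambda>k. ereal (enn2real (I k) / (1 - (1 - S k) * enn2real (I k)))) \<longlonglongrightarrow> enn2ereal K"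
      using \<kappa> by simp
    then show ?thesis by (rule tendsto_sandwich[OF low up IK'])
  qed
  then show "?D \<longlonglongrightarrow> renyi_outer 1 (\<integral>\<^sup>+x. renyi_inner 1 (X x) \<partial>M)"
    by (simp add: renyi_outer_def K_def)
qed simp

section \<open>Divergence of restricted measures\<close>

lemma common_density:
  assumes P: "prob_space P" and Q: "prob_space Q" and sets: "sets Q = sets P"
  obtains M and p :: "'a \<Rightarrow> real" where "finite_measure M" "sets M = sets P" "p \<in> borel_measurable M"
    "\<And>x. 0 \<le> p x" "\<And>x. p x \<le> 1" "P = density M p" "Q = density M (\<lambda>x. 1 - p x)"
proof -
  define M where "M = sum_measure P Q"
  have sM [measurable_cong]: "sets M = sets P"
    unfolding M_def sum_measure_def by (simp add: sets.sets_measure_of_eq)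
  have spM: "space M = space P" using sM by (rule sets_eq_imp_space_eq)
  have em: "emeasure M A = emeasure P A + emeasure Q A" if "A \<in> sets P" for A
  proof (rule emeasure_measure_of[OF M_def[unfolded sum_measure_def]])
    show "countably_additive (sets M) (\<lambda>A. emeasure P A + emeasure Q A)"
      unfolding sM by (intro countably_additiveI)
        (simp add: suminf_emeasure sets image_subset_iff sets.countable_UN suminf_add[symmetric])
  qed (use that sM sets.sets_into_space in \<open>auto simp: positive_def\<close>)
  interpret M: finite_measure M
  proof (rule finite_measureI)
    show "emeasure M (space M) \<noteq> \<infinity>"
      using em[of "space P"] prob_space.emeasure_space_1[OF P] prob_space.emeasure_space_1[OF Q]
        sets_eq_imp_space_eq[OF sets] by (simp add: spM)
  qed
  have "absolutely_continuous M P" "absolutely_continuous M Q"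
    by (auto simp: absolutely_continuous_def null_sets_def sM em sets)
  then obtain f g where [measurable]: "f \<in> borel_measurable M" "g \<in> borel_measurable M"
    and f: "density M f = P" and g: "density M g = Q"
    using M.Radon_Nikodym[of P] M.Radon_Nikodym[of Q] sM sets by metis
  \<comment> \<open>As M = P + Q, the function f + g is a density of M with respect to itself, and
    uniqueness of densities makes it 1 almost everywhere.\<close>
  have "density M (\<lambda>x. f x + g x) = density M (\<lambda>x. 1)"
  proof (rule measure_eqI)
    fix A assume "A \<in> sets (density M (\<lambda>x. f x + g x))"
    then have A [measurable]: "A \<in> sets M" by simp
    have "emeasure (density M (\<lambda>x. f x + g x)) A = emeasure (density M f) A + emeasure (density M g) A"
      by (simp add: emeasure_density distrib_right nn_integral_add)
    also have "\<dots> = emeasure M A" using A by (simp add: f g em sM)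
    finally show "emeasure (density M (\<lambda>x. f x + g x)) A = emeasure (density M (\<lambda>x. 1)) A"
      by (simp add: density_1)
  qed simp
  then have fg: "AE x in M. f x + g x = 1" by (subst (asm) M.density_unique_iff) auto
  \<comment> \<open>The minimum makes the bounds hold at every point and alters the density on a
    null set only.\<close>
  define p where "p x = min 1 (enn2real (f x))" for x
  have [measurable]: "p \<in> borel_measurable M" unfolding p_def by measurable
  have fp: "AE x in M. f x = ennreal (p x) \<and> g x = ennreal (1 - p x)"
    using fg
  proof eventually_elim
    case (elim x)
    then have "f x \<noteq> \<infinity>" "g x \<noteq> \<infinity>" by auto
    then obtain a b where ab: "0 \<le> a" "f x = ennreal a" "0 \<le> b" "g x = ennreal b"
      by (cases "f x"; cases "g x") auto
    then have "ennreal (a + b) = ennreal 1" using elim by simp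
    then have "a + b = 1" using ab by (subst (asm) ennreal_inj) auto
    then show ?case using ab by (auto simp: p_def min_def intro: arg_cong[where f = ennreal])
  qed
  show thesis
  proof (rule that[of M p])
    show "P = density M p"
      unfolding f[symmetric] by (rule density_cong) (use fp in auto)
    show "Q = density M (\<lambda>x. 1 - p x)"
      unfolding g[symmetric] by (rule density_cong) (use fp in auto)
  qed (auto simp: p_def sM M.finite_measure_axioms)
qed

text \<open>On sets of the sub-\<sigma>-algebra this is the defining property of conditional
  expectation. A separate version g is allowed because \<open>real_cond_exp\<close> is nonnegative
  only almost everywhere.\<close>

lemma (in finite_measure_subalgebra) restr_to_subalg_density:
  assumes f: "integrable M f" "\<And>x. 0 \<le> f x"
    and g [measurable]: "g \<in> borel_measurable F" "\<And>x. 0 \<le> g x"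
    and eq: "AE x in M. g x = real_cond_exp M F f x"
  shows "restr_to_subalg (density M f) F = density (restr_to_subalg M F) g"
proof (rule measure_eqI)
  have sub: "subalgebra (density M f) F" using subalg by (simp add: subalgebra_def)
  note [measurable] = borel_measurable_integrable[OF f(1)] measurable_from_subalg[OF subalg g(1)]
  have gR [measurable]: "g \<in> borel_measurable (restr_to_subalg M F)"
    by (rule measurable_in_subalg[OF subalg g(1)])
  have gi: "integrable M g"
    using real_cond_exp_int(1)[OF f(1)] eq by (subst integrable_cong_AE[of _ _ "real_cond_exp M F f"]) auto
  show s: "sets (restr_to_subalg (density M f) F) = sets (density (restr_to_subalg M F) g)"
    by (simp add: sets_restr_to_subalg[OF sub] sets_restr_to_subalg[OF subalg])
  fix A assume "A \<in> sets (restr_to_subalg (density M f) F)"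
  then have A [measurable]: "A \<in> sets F" by (simp add: sets_restr_to_subalg[OF sub])
  then have [measurable]: "A \<in> sets M" using subalg by (auto simp: subalgebra_def)
  have ind: "(\<lambda>x. ennreal (h x) * indicator A x) = (\<lambda>x. ennreal (indicator A x * h x))" for h :: "'a \<Rightarrow> real"
    by (auto simp: indicator_def)
  have "emeasure (restr_to_subalg (density M f) F) A = (\<integral>\<^sup>+x. ennreal (f x) * indicator A x \<partial>M)"
    by (simp add: emeasure_restr_to_subalg[OF sub A] emeasure_density)
  also have "\<dots> = ennreal (\<integral>x. indicator A x * f x \<partial>M)"
    unfolding ind using integrable_mult_indicator[OF \<open>A \<in> sets M\<close> f(1)] f(2)
    by (intro nn_integral_eq_integral) auto
  also have "(\<integral>x. indicator A x * f x \<partial>M) = (\<integral>x. indicator A x * real_cond_exp M F f x \<partial>M)"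
    using real_cond_exp_intA[OF f(1) A] by (simp add: set_lebesgue_integral_def)
  also have "\<dots> = (\<integral>x. indicator A x * g x \<partial>M)"
    using eq by (intro integral_cong_AE) auto
  also have "ennreal \<dots> = (\<integral>\<^sup>+x. ennreal (g x) * indicator A x \<partial>M)"
    unfolding ind using integrable_mult_indicator[OF \<open>A \<in> sets M\<close> gi] g(2)
    by (intro nn_integral_eq_integral[symmetric]) auto
  also have "\<dots> = (\<integral>\<^sup>+x. ennreal (g x) * indicator A x \<partial>restr_to_subalg M F)"
    by (rule nn_integral_subalgebra2[OF subalg, symmetric]) measurable
  also have "\<dots> = emeasure (density (restr_to_subalg M F) g) A"
    using A by (subst emeasure_density) (auto simp: sets_restr_to_subalg[OF subalg])
  finally show "emeasure (restr_to_subalg (density M f) F) A = emeasure (density (restr_to_subalg M F) g) A" .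
qed

text \<open>Both restrictions have densities with respect to the restriction of M, so
  \<open>renyi_simple_density\<close> evaluates all positive orders other than 1, and the orders 0
  and 1 follow by the limits in the order. The integral moves back to M because its integrand is
  measurable for the sub-\<sigma>-algebra.\<close>

lemma (in finite_measure_subalgebra) renyi_divergence_restr_to_subalg:
  fixes p :: "'a \<Rightarrow> real"
  assumes [measurable]: "p \<in> borel_measurable M" and p01: "\<And>x. 0 \<le> p x" "\<And>x. p x \<le> 1"
    and P: "prob_space (density M p)" and Q: "prob_space (density M (\<lambda>x. 1 - p x))"
    and \<alpha>: "0 \<le> \<alpha>"
  shows "renyi_divergence \<alpha> (restr_to_subalg (density M p) F) (restr_to_subalg (density M (\<lambda>x. 1 - p x)) F)
    = renyi_outer \<alpha> (\<integral>\<^sup>+x. renyi_inner \<alpha> (real_cond_exp M F p x) \<partial>M)"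
proof -
  let ?X = "real_cond_exp M F p" and ?R = "restr_to_subalg M F"
  let ?P = "restr_to_subalg (density M p) F" and ?Q = "restr_to_subalg (density M (\<lambda>x. 1 - p x)) F"
  \<comment> \<open>The conditional expectation lies in [0,1] only almost everywhere, while
    \<open>renyi_simple_density\<close> asks for densities that are nonnegative at every
    point.\<close>
  define g where "g x = max 0 (min 1 (?X x))" for x
  have pi: "integrable M p" by (rule integrable_const_bound[of _ 1]) (auto simp: p01)
  have qi: "integrable M (\<lambda>x. 1 - p x)" using pi by simp
  have X01: "AE x in M. 0 \<le> ?X x \<and> ?X x \<le> 1" by (rule real_cond_exp_01[OF pi]) (simp add: p01)
  then have gX: "AE x in M. g x = ?X x" by eventually_elim (simp add: g_def)
  have gF [measurable]: "g \<in> borel_measurable F" unfolding g_def by measurable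
  have gR [measurable]: "g \<in> borel_measurable ?R" by (rule measurable_in_subalg[OF subalg gF])
  have [measurable]: "?X \<in> borel_measurable M" by (rule borel_measurable_cond_exp2)
  have "AE x in M. 1 - g x = real_cond_exp M F (\<lambda>x. 1 - p x) x"
    using gX real_cond_exp_affine[OF pi, of 1 "-1", simplified] by eventually_elim simp
  then have Q': "?Q = density ?R (\<lambda>x. 1 - g x)"
    by (intro restr_to_subalg_density qi) (auto simp: p01 g_def)
  have P': "?P = density ?R g"
    by (intro restr_to_subalg_density pi gX) (auto simp: p01 g_def)
  have subP: "subalgebra (density M f) F" for f :: "'a \<Rightarrow> ennreal"
    using subalg by (simp add: subalgebra_def)
  note PR = prob_space_restr_to_subalg[OF subP P, unfolded P']
  note QR = prob_space_restr_to_subalg[OF subP Q, unfolded Q']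
  have simple: "renyi_simple \<beta> ?P ?Q = renyi_outer \<beta> (\<integral>\<^sup>+x. renyi_inner \<beta> (?X x) \<partial>M)"
    if \<beta>: "0 < \<beta>" "\<beta> \<noteq> 1" for \<beta>
  proof -
    have "renyi_simple \<beta> ?P ?Q = ereal (1 / (\<beta> - 1)) * ln_ennreal (\<integral>\<^sup>+x. renyi_integrand \<beta> (g x) (1 - g x) \<partial>?R)"
      unfolding P' Q' by (rule renyi_simple_density[OF gR _ _ _ PR QR \<beta>]) (measurable, simp_all add: g_def)
    also have "(\<integral>\<^sup>+x. renyi_integrand \<beta> (g x) (1 - g x) \<partial>?R) = (\<integral>\<^sup>+x. renyi_inner \<beta> (g x) \<partial>?R)"
      using \<beta> by (simp add: renyi_inner_def)
    also have "\<dots> = (\<integral>\<^sup>+x. renyi_inner \<beta> (g x) \<partial>M)"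
      by (rule nn_integral_subalgebra2[OF subalg]) measurable
    also have "\<dots> = (\<integral>\<^sup>+x. renyi_inner \<beta> (?X x) \<partial>M)"
      using gX by (intro nn_integral_cong_AE, eventually_elim) simp
    finally show ?thesis using \<beta> by (simp add: renyi_outer_def)
  qed
  consider "\<alpha> = 0" | "\<alpha> = 1" | "0 < \<alpha>" "\<alpha> \<noteq> 1" using \<alpha> by linarith
  then show ?thesis
  proof cases
    case 1
    have "\<forall>\<^sub>F \<beta> in at_right 0. renyi_outer \<beta> (\<integral>\<^sup>+x. renyi_inner \<beta> (?X x) \<partial>M) = renyi_simple \<beta> ?P ?Q"
      using eventually_at_right_real[OF zero_less_one] by eventually_elim (auto simp: simple)
    from Lim_transform_eventually[OF tendsto_renyi_order_0[OF _ X01] this]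
    have "Lim (at_right 0) (\<lambda>\<beta>. renyi_simple \<beta> ?P ?Q) = renyi_outer 0 (\<integral>\<^sup>+x. renyi_inner 0 (?X x) \<partial>M)"
      by (intro tendsto_Lim) auto
    then show ?thesis by (simp add: 1 renyi_divergence_def)
  next
    case 2
    have one: "(\<integral>x. p x \<partial>M) = 1" "(\<integral>x. 1 - p x \<partial>M) = 1"
    proof -
      have "(\<integral>\<^sup>+x. ennreal (p x) \<partial>M) = 1" "(\<integral>\<^sup>+x. ennreal (1 - p x) \<partial>M) = 1"
        using prob_space.emeasure_space_1[OF P] prob_space.emeasure_space_1[OF Q]
        by (simp_all add: emeasure_density cong: nn_integral_cong)
      then show "(\<integral>x. p x \<partial>M) = 1" "(\<integral>x. 1 - p x \<partial>M) = 1"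
        by (auto simp: p01 integral_eq_nn_integral)
    qed
    have Xi: "integrable M ?X" "(\<integral>x. ?X x \<partial>M) = (\<integral>x. p x \<partial>M)" by (rule real_cond_exp_int[OF pi])+
    have pX: "(\<integral>\<^sup>+x. ennreal (?X x) \<partial>M) = 1"
      using X01 Xi one by (subst nn_integral_eq_integral) auto
    have qX: "(\<integral>\<^sup>+x. ennreal (1 - ?X x) \<partial>M) = 1"
      using X01 Xi one pi by (subst nn_integral_eq_integral) auto
    have "\<forall>\<^sub>F \<beta> in at_left 1. renyi_outer \<beta> (\<integral>\<^sup>+x. renyi_inner \<beta> (?X x) \<partial>M) = renyi_simple \<beta> ?P ?Q"
      using eventually_at_left_real[OF zero_less_one] by eventually_elim (auto simp: simple)
    from Lim_transform_eventually[OF tendsto_renyi_order_1[OF _ X01 pX qX] this]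
    have "Lim (at_left 1) (\<lambda>\<beta>. renyi_simple \<beta> ?P ?Q) = renyi_outer 1 (\<integral>\<^sup>+x. renyi_inner 1 (?X x) \<partial>M)"
      by (intro tendsto_Lim) auto
    then show ?thesis by (simp add: 2 renyi_divergence_def)
  next
    case 3
    then show ?thesis by (simp add: renyi_divergence_def simple)
  qed
qed

theorem theorem22:
  fixes P Q :: "'a measure" and F :: "nat \<Rightarrow> 'a measure" and \<alpha> :: real
  assumes "prob_space P" and "prob_space Q" and "sets Q = sets P"
    and "\<And>n. subalgebra P (F n)"
    and "\<And>n. sets (F (Suc n)) \<subseteq> sets (F n)"
    and "0 \<le> \<alpha>"
    and "\<alpha> < 1 \<or> (\<exists>m. renyi_divergence \<alpha> (restr_to_subalg P (F m)) (restr_to_subalg Q (F m)) < \<infinity>)"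
  shows "(\<lambda>n. renyi_divergence \<alpha> (restr_to_subalg P (F n)) (restr_to_subalg Q (F n)))
    \<longlonglongrightarrow> renyi_divergence \<alpha> (restr_to_subalg P (inter_algebra F)) (restr_to_subalg Q (inter_algebra F))"
proof -
  obtain M and p :: "'a \<Rightarrow> real" where fin: "finite_measure M" and sets: "sets M = sets P"
    and p: "p \<in> borel_measurable M" "\<And>x. 0 \<le> p x" "\<And>x. p x \<le> 1"
    and P: "P = density M p" and Q: "Q = density M (\<lambda>x. 1 - p x)"
    using common_density[OF assms(1-3)] by blast
  have "subalgebra M (F n)" for n
    using assms(4)[of n] sets sets_eq_imp_space_eq[OF sets] by (simp add: subalgebra_def)
  then interpret backward_filtration M F
    by (intro backward_filtration.intro backward_filtration_axioms.intro fin assms(5))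
  note PQ = assms(1,2)[unfolded P Q]
  have pi: "integrable M p" by (rule integrable_const_bound[of _ 1]) (auto simp: p)
  have p01: "AE x in M. 0 \<le> p x \<and> p x \<le> 1" by (simp add: p)
  have D: "renyi_divergence \<alpha> (restr_to_subalg P (F n)) (restr_to_subalg Q (F n))
      = renyi_outer \<alpha> (\<integral>\<^sup>+x. renyi_inner \<alpha> (E (F n) p x) \<partial>M)" for n
    unfolding P Q by (rule F.renyi_divergence_restr_to_subalg[OF p PQ assms(6)])
  have D_inter: "renyi_divergence \<alpha> (restr_to_subalg P (inter_algebra F)) (restr_to_subalg Q (inter_algebra F))
      = renyi_outer \<alpha> (\<integral>\<^sup>+x. renyi_inner \<alpha> (E (inter_algebra F) p x) \<partial>M)"
    unfolding P Q by (rule Inf.renyi_divergence_restr_to_subalg[OF p PQ assms(6)])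
  have "\<alpha> < 1 \<or> (\<exists>m. (\<integral>\<^sup>+x. renyi_inner \<alpha> (E (F m) p x) \<partial>M) < \<infinity>)"
    using assms(7) renyi_outer_less_infinity[of \<alpha>] unfolding D by fastforce
  from nn_integral_renyi_inner_tendsto[OF pi p01 assms(6) this]
  show ?thesis unfolding D D_inter by (rule tendsto_renyi_outer)
qed

end
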